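(* Let $d\ge 1$ be an integer and let $X_N$ be a set of $N$ independent, identically and uniformly distributed random points on $\mathbb{S}^d$. Then $$\mathbb{E}\big[N^{2/d}\,\vartheta(X_N)\big]\to C_d:=\left(\frac{\kappa_d}{2}\right)^{-1/d}\Gamma(1+1/d)\qquad\text{as }N\to\infty.$$ Furthermore, $$\operatorname{Var}\big(N^{2/d}\,\vartheta(X_N)\big)\to\left(\frac{\kappa_d}{2}\right)^{-2/d}\Big(\Gamma(1+2/d)-[\Gamma(1+1/d)]^2\Big)\qquad\text{as }N\to\infty.$$
   Context: $\mathbb{S}^d$ is the unit sphere in $\mathbb{R}^{d+1}$; uniform means with respect to normalized surface area measure. The (geodesic) separation distance of $X_N=\{\mathbf{x}_1,\dots,\mathbf{x}_N\}\subset\mathbb{S}^d$ is $\vartheta(X_N):=\min_{1\le j<k\le N}\arccos(\mathbf{x}_j\cdot\mathbf{x}_k)$. The constant $\kappa_d$ is $\kappa_d:=\frac1d\frac{\Gamma((d+1)/2)}{\sqrt\pi\,\Gamma(d/2)}$. *)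

theory Defs
  imports "HOL-Probability.Probability"
begin

(* Surface area on the unit sphere of R^n through polar coordinates: the area of A is n times the
   Lebesgue measure of the cone {r x | 0 < r <= 1, x in A}.  The cone over A is the preimage of A
   under x |-> sgn x = x / |x| on the punctured closed unit ball; the explicit formula is
   emeasure_sphere_area below. *)
definition sphere_area :: "(real ^ 'n) measure" where
  "sphere_area = scale_measure (of_nat CARD('n))
     (distr (restrict_space lborel (cball 0 1 - {0})) (restrict_space borel (sphere 0 1)) sgn)"

definition uniform_sphere :: "(real ^ 'n) measure" where
  "uniform_sphere = uniform_measure sphere_area (sphere 0 1)"

(* The minimum runs over pairs of indices, so coinciding points have separation 0.  It is taken
   over a nonempty set only for N >= 2; smaller N give an unspecified value. *)
definition separation :: "nat \<Rightarrow> (nat \<Rightarrow> real ^ 'n) \<Rightarrow> real" where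
  "separation N x = Min {arccos (x j \<bullet> x k) | j k. 1 \<le> j \<and> j < k \<and> k \<le> N}"

definition kappa :: "nat \<Rightarrow> real" where
  "kappa d = 1 / real d * (Gamma ((real d + 1) / 2) / (sqrt pi * Gamma (real d / 2)))"

lemma space_sphere_area [simp]: "space (sphere_area :: (real ^ 'n) measure) = sphere 0 1"
  by (simp add: sphere_area_def space_scale_measure space_restrict_space)

lemma sets_sphere_area [simp, measurable_cong]:
  "sets (sphere_area :: (real ^ 'n) measure) = sets (restrict_space borel (sphere 0 1))"
  by (simp add: sphere_area_def)

lemma space_uniform_sphere [simp]: "space (uniform_sphere :: (real ^ 'n) measure) = sphere 0 1"
  by (simp add: uniform_sphere_def)

lemma sets_uniform_sphere [simp, measurable_cong]:
  "sets (uniform_sphere :: (real ^ 'n) measure) = sets (restrict_space borel (sphere 0 1))"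
  by (simp add: uniform_sphere_def)

lemma measurable_sgn_sphere:
  "(sgn :: real ^ 'n \<Rightarrow> real ^ 'n) \<in>
     restrict_space lborel (cball 0 1 - {0}) \<rightarrow>\<^sub>M restrict_space borel (sphere 0 1)"
proof (rule measurable_restrict_space2)
  show "(sgn :: real ^ 'n \<Rightarrow> real ^ 'n) \<in>
      space (restrict_space lborel (cball 0 1 - {0})) \<rightarrow> sphere 0 1"
    by (auto simp: space_restrict_space norm_sgn)
  have "(sgn :: real ^ 'n \<Rightarrow> real ^ 'n) = (\<lambda>x. x /\<^sub>R norm x)"
    by (auto simp: sgn_div_norm)
  moreover have "(\<lambda>x :: real ^ 'n. x /\<^sub>R norm x) \<in> borel_measurable borel"
    by measurable
  ultimately have "(sgn :: real ^ 'n \<Rightarrow> real ^ 'n) \<in> borel_measurable lborel"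
    by simp
  then show "(sgn :: real ^ 'n \<Rightarrow> real ^ 'n) \<in>
      restrict_space lborel (cball 0 1 - {0}) \<rightarrow>\<^sub>M borel"
    by (rule measurable_restrict_space1)
qed

lemma emeasure_sphere_area:
  fixes A :: "(real ^ 'n) set"
  assumes "A \<in> sets borel" "A \<subseteq> sphere 0 1"
  shows "emeasure sphere_area A =
    of_nat CARD('n) * emeasure lborel {r *\<^sub>R x | r x. 0 < r \<and> r \<le> 1 \<and> x \<in> A}"
proof -
  let ?B = "cball 0 1 - {0} :: (real ^ 'n) set"
  have A: "A \<in> sets (restrict_space borel (sphere 0 1))"
    using assms by (simp add: sets_restrict_space_iff)
  have eq: "sgn -` A \<inter> ?B = {r *\<^sub>R x | r x. 0 < r \<and> r \<le> 1 \<and> x \<in> A}" (is "?L = ?R")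
  proof (intro equalityI subsetI)
    fix y assume y: "y \<in> ?L"
    then have "y = norm y *\<^sub>R sgn y" "0 < norm y" "norm y \<le> 1" "sgn y \<in> A"
      by (auto simp: sgn_div_norm)
    then show "y \<in> ?R" by blast
  next
    fix y assume "y \<in> ?R"
    then obtain r x where y: "y = r *\<^sub>R x" "0 < r" "r \<le> 1" "x \<in> A" by blast
    moreover from this have "norm x = 1" using assms(2) by auto
    ultimately show "y \<in> ?L"
      by (auto simp: sgn_div_norm)
  qed
  have "emeasure sphere_area A = of_nat CARD('n) *
      emeasure (restrict_space lborel ?B) (sgn -` A \<inter> space (restrict_space lborel ?B))"
    by (simp add: sphere_area_def emeasure_distr [OF measurable_sgn_sphere A])
  also have "\<dots> = of_nat CARD('n) * emeasure lborel (sgn -` A \<inter> ?B)"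
    by (subst emeasure_restrict_space) (auto simp: space_restrict_space)
  finally show ?thesis
    by (simp only: eq)
qed

lemma prob_space_uniform_sphere: "prob_space (uniform_sphere :: (real ^ 'n) measure)"
  unfolding uniform_sphere_def
proof (rule prob_space_uniform_measure)
  have "{r *\<^sub>R x | r x. 0 < r \<and> r \<le> 1 \<and> x \<in> sphere 0 1} = (cball 0 1 - {0} :: (real ^ 'n) set)"
    (is "?L = ?R")
  proof (intro equalityI subsetI)
    fix y assume "y \<in> ?R"
    then have "y = norm y *\<^sub>R sgn y" "0 < norm y" "norm y \<le> 1" "sgn y \<in> sphere 0 1"
      by (auto simp: sgn_div_norm)
    then show "y \<in> ?L" by blast
  qed auto
  moreover have "emeasure lborel (cball 0 1 - {0} :: (real ^ 'n) set)
      = emeasure lborel (cball 0 1 :: (real ^ 'n) set)"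
    by (subst emeasure_Diff) auto
  ultimately have *: "emeasure sphere_area (sphere 0 1 :: (real ^ 'n) set)
      = of_nat CARD('n) * emeasure lborel (cball 0 1 :: (real ^ 'n) set)"
    by (simp add: emeasure_sphere_area)
  have "0 < emeasure lborel (ball 0 1 :: (real ^ 'n) set)"
    by (simp add: emeasure_ball unit_ball_vol_pos)
  also have "\<dots> \<le> emeasure lborel (cball 0 1 :: (real ^ 'n) set)"
    by (intro emeasure_mono) auto
  finally show "emeasure sphere_area (sphere 0 1 :: (real ^ 'n) set) \<noteq> 0"
    by (simp add: *)
  show "emeasure sphere_area (sphere 0 1 :: (real ^ 'n) set) \<noteq> \<infinity>"
    using emeasure_lborel_cball_finite [of "0 :: real ^ 'n" 1]
    by (auto simp: * ennreal_mult_eq_top_iff)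
qed

end

theory Submission
  imports Defs
begin

text \<open>Two points of the sphere are called close at radius \<open>r\<close> if their geodesic distance is at most
\<open>r\<close>. Writing \<open>p(r)\<close> for the normalized area of a cap of radius \<open>r\<close>, the separation of \<open>N\<close> random
points exceeds \<open>r\<close> exactly when none of the roughly \<open>N\<^sup>2 / 2\<close> pairs is close, each pair being close
with probability \<open>p(r) \<approx> \<kappa>\<^sub>d r\<^sup>d\<close>. At the scale \<open>r = t N\<^bsup>-2/d\<^esup>\<close> the expected number of close pairs
tends to \<open>\<kappa>\<^sub>d t\<^sup>d / 2\<close>, and the number of close pairs is asymptotically Poisson. So the rescaled
separation converges in law to the Weibull distribution with tail \<open>exp (- \<kappa>\<^sub>d t\<^sup>d / 2)\<close>, whose \<open>m\<close>-th
moment is \<open>(\<kappa>\<^sub>d / 2)\<^bsup>-m/d\<^esup> \<Gamma>(1 + m/d)\<close>. The claims are the convergence of the first two moments.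

The Poisson limit is obtained by adding the points one at a time. If the first \<open>j\<close> points have no
close pair, the next one must avoid a union of \<open>j\<close> caps. The area of this union is at most \<open>j p\<close>, and
at least \<open>j p\<close> minus the areas of the pairwise intersections, whose expectations are \<open>p\<^sup>2\<close> each. Hence the
tail lies between \<open>\<Prod>\<^bsub>j<N\<^esub> (1 - j p)\<close> and this product plus \<open>N\<^sup>3 p\<^sup>2\<close> (\<open>prob_avoiding_ge\<close>,
\<open>prob_avoiding_le\<close>); with \<open>p\<close> of order \<open>N\<^bsup>-2\<^esup>\<close> the error vanishes and the product tends to the desired
exponential.

Convergence of moments needs a bound on the tails uniform in \<open>N\<close>. Around points that are pairwise
further than \<open>r\<close> apart, the caps of radius \<open>r / 6\<close> are disjoint, so the union of \<open>j\<close> caps of radius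
\<open>r\<close> has area at least \<open>j p(r/6)\<close>, which is at least a constant times \<open>j r\<^sup>d\<close>. This gives a bound
\<open>exp (- c t\<^sup>d)\<close> for every \<open>N \<ge> 2\<close> (\<open>separation_tail_le\<close>), and dominated convergence in the layer-cake
formula \<open>E Y\<^sup>m = \<integral> m t\<^bsup>m-1\<^esup> P(Y > t) dt\<close> finishes the proof.

The area of a cap is the volume of the solid sector over it divided by the volume of the unit ball. By rotation
invariance the axis may be a coordinate axis, and then the sector is squeezed between two right
circular cones, whose volumes are explicit; this yields \<open>p(r) / r\<^sup>d \<longlongrightarrow> \<kappa>\<^sub>d\<close>.\<close>

section \<open>Products of complementary probabilities\<close>

lemma sum_real_lessThan: "(\<Sum>j<N. real j) = real N * (real N - 1) / 2"
  by (induction N) (auto simp: field_simps)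

lemma prod_one_minus_le_exp:
  fixes p :: real
  assumes "0 \<le> p" "real N * p \<le> 1"
  shows "(\<Prod>j<N. 1 - real j * p) \<le> exp (- (real N * (real N - 1) / 2 * p))"
proof -
  have "(\<Prod>j<N. 1 - real j * p) \<le> (\<Prod>j<N. exp (- (real j * p)))"
  proof (rule prod_mono)
    fix j assume "j \<in> {..<N}"
    then have "real j * p \<le> real N * p" using assms by (intro mult_right_mono) auto
    then show "0 \<le> 1 - real j * p \<and> 1 - real j * p \<le> exp (- (real j * p))"
      using assms exp_ge_add_one_self [of "- (real j * p)"] by auto
  qed
  also have "\<dots> = exp (- ((\<Sum>j<N. real j) * p))"
    by (simp add: exp_sum [symmetric] sum_negf sum_distrib_right)
  finally show ?thesis by (simp only: sum_real_lessThan)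
qed

lemma one_minus_ge_exp:
  fixes x :: real
  assumes "x < 1"
  shows "exp (- (x / (1 - x))) \<le> 1 - x"
proof -
  have "1 / (1 - x) = 1 + x / (1 - x)" using assms by (simp add: field_simps)
  also have "\<dots> \<le> exp (x / (1 - x))" by (rule exp_ge_add_one_self)
  finally show ?thesis using assms by (simp add: exp_minus field_simps)
qed

lemma prod_one_minus_ge_exp:
  fixes p :: real
  assumes "0 \<le> p" "real N * p < 1"
  shows "exp (- (real N * (real N - 1) / 2 * (p / (1 - real N * p)))) \<le> (\<Prod>j<N. 1 - real j * p)"
proof -
  have "exp (- (real N * (real N - 1) / 2 * (p / (1 - real N * p))))
      = exp (- ((\<Sum>j<N. real j) * (p / (1 - real N * p))))"
    by (simp only: sum_real_lessThan)
  also have "\<dots> = (\<Prod>j<N. exp (- (real j * (p / (1 - real N * p)))))"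
    by (simp only: exp_sum [OF finite_lessThan, symmetric] sum_negf sum_distrib_right)
  also have "\<dots> \<le> (\<Prod>j<N. 1 - real j * p)"
  proof (rule prod_mono)
    fix j assume "j \<in> {..<N}"
    then have j: "real j * p \<le> real N * p" using assms by (intro mult_right_mono) auto
    have "exp (- (real j * (p / (1 - real N * p)))) \<le> exp (- (real j * p / (1 - real j * p)))"
    proof -
      have "real j * p / (1 - real j * p) \<le> real j * p / (1 - real N * p)"
        using j assms by (intro divide_left_mono mult_pos_pos) auto
      then show ?thesis by simp
    qed
    also have "\<dots> \<le> 1 - real j * p"
      using j assms by (intro one_minus_ge_exp) linarith
    finally show "0 \<le> exp (- (real j * (p / (1 - real N * p)))) \<and>
      exp (- (real j * (p / (1 - real N * p)))) \<le> 1 - real j * p" by simp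
  qed
  finally show ?thesis .
qed

text \<open>The logarithm of the product is \<open>- p N (N - 1) / 2\<close> up to a factor tending to \<open>1\<close>, because
\<open>N p\<close> tends to \<open>0\<close>; the two preceding inequalities make this precise.\<close>

lemma prod_one_minus_tendsto:
  fixes p :: "nat \<Rightarrow> real"
  assumes p: "\<And>N. 0 \<le> p N" and lim: "(\<lambda>N. (real N)\<^sup>2 * p N) \<longlonglongrightarrow> c"
  shows "(\<lambda>N. \<Prod>j<N. 1 - real j * p N) \<longlonglongrightarrow> exp (- (c / 2))"
proof -
  have inv: "(\<lambda>N. 1 / real N) \<longlonglongrightarrow> 0" by (rule lim_1_over_n)
  have "(\<lambda>N. (real N)\<^sup>2 * p N * (1 / real N)) \<longlonglongrightarrow> c * 0"
    by (intro tendsto_mult lim inv)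
  then have small: "(\<lambda>N. real N * p N) \<longlonglongrightarrow> 0"
    by (rule Lim_transform_eventually [OF tendsto_eq_rhs])
       (auto intro!: eventually_sequentiallyI [of 1] simp: power2_eq_square)
  then have small1: "\<forall>\<^sub>F N in sequentially. real N * p N < 1"
    by (rule order_tendstoD) simp
  have "(\<lambda>N. (real N)\<^sup>2 * p N * (1 - 1 / real N) / 2) \<longlonglongrightarrow> c * (1 - 0) / 2"
    by (intro tendsto_intros lim inv) auto
  then have half: "(\<lambda>N. real N * (real N - 1) / 2 * p N) \<longlonglongrightarrow> c / 2"
    by (rule Lim_transform_eventually [OF tendsto_eq_rhs])
       (auto intro!: eventually_sequentiallyI [of 1] simp: power2_eq_square field_simps)
  have "(\<lambda>N. real N * (real N - 1) / 2 * p N / (1 - real N * p N)) \<longlonglongrightarrow> c / 2 / (1 - 0)"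
    by (intro tendsto_intros half small) auto
  then have half': "(\<lambda>N. real N * (real N - 1) / 2 * (p N / (1 - real N * p N))) \<longlonglongrightarrow> c / 2"
    by simp
  show ?thesis
  proof (rule tendsto_sandwich)
    show "\<forall>\<^sub>F N in sequentially. exp (- (real N * (real N - 1) / 2 * (p N / (1 - real N * p N))))
        \<le> (\<Prod>j<N. 1 - real j * p N)"
      using small1 by eventually_elim (intro prod_one_minus_ge_exp p)
    show "\<forall>\<^sub>F N in sequentially. (\<Prod>j<N. 1 - real j * p N)
        \<le> exp (- (real N * (real N - 1) / 2 * p N))"
      using small1 by eventually_elim (intro prod_one_minus_le_exp p, simp)
  qed (intro tendsto_intros half half')+
qed

section \<open>Moments from tail probabilities\<close>

text \<open>Write \<open>y\<^sup>m\<close> as the integral of its derivative over \<open>0 < t < y\<close> and exchange the two integrals.\<close>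

lemma nn_integral_power_layer_cake:
  fixes Y :: "'a \<Rightarrow> real"
  assumes "sigma_finite_measure M" and [measurable]: "Y \<in> borel_measurable M"
    and Y: "\<And>x. x \<in> space M \<Longrightarrow> 0 \<le> Y x" and m: "m \<ge> 1"
  shows "(\<integral>\<^sup>+x. ennreal (Y x ^ m) \<partial>M) =
    (\<integral>\<^sup>+t. ennreal (real m * t ^ (m - 1)) * indicator {0<..} t * emeasure M {x \<in> space M. t < Y x} \<partial>lborel)"
proof -
  interpret sigma_finite_measure M by fact
  interpret pair_sigma_finite M lborel ..
  have "ennreal (y ^ m) =
     (\<integral>\<^sup>+t. ennreal (real m * t ^ (m - 1)) * indicator {0<..} t * indicator {..<y} t \<partial>lborel)"
    if "0 \<le> y" for y :: real
  proof -
    have "(\<integral>\<^sup>+t. ennreal (real m * t ^ (m - 1)) * indicator {0..y} t \<partial>lborel) = y ^ m - 0 ^ m"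
      by (rule nn_integral_FTC_Icc) (use that in \<open>auto intro!: derivative_eq_intros\<close>)
    also have "(\<integral>\<^sup>+t. ennreal (real m * t ^ (m - 1)) * indicator {0..y} t \<partial>lborel) =
      (\<integral>\<^sup>+t. ennreal (real m * t ^ (m - 1)) * indicator {0<..} t * indicator {..<y} t \<partial>lborel)"
    proof (rule nn_integral_cong_AE)
      have "AE t in lborel. t \<noteq> 0 \<and> t \<noteq> y"
        using AE_lborel_singleton [of 0] AE_lborel_singleton [of y] by eventually_elim simp
      then show "AE t in lborel. ennreal (real m * t ^ (m - 1)) * indicator {0..y} t =
         ennreal (real m * t ^ (m - 1)) * indicator {0<..} t * indicator {..<y} t"
        by eventually_elim (auto split: split_indicator)
    qed
    finally show ?thesis using m by (simp add: power_0_left)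
  qed
  then have "(\<integral>\<^sup>+x. ennreal (Y x ^ m) \<partial>M) = (\<integral>\<^sup>+x. \<integral>\<^sup>+t. ennreal (real m * t ^ (m - 1)) *
      indicator {0<..} t * indicator {..<Y x} t \<partial>lborel \<partial>M)"
    by (intro nn_integral_cong) (simp add: Y)
  also have "\<dots> = (\<integral>\<^sup>+t. \<integral>\<^sup>+x. ennreal (real m * t ^ (m - 1)) *
      indicator {0<..} t * indicator {..<Y x} t \<partial>M \<partial>lborel)"
    by (rule Fubini' [symmetric]) (simp add: lessThan_def, measurable)
  also have "\<dots> = (\<integral>\<^sup>+t. ennreal (real m * t ^ (m - 1)) * indicator {0<..} t * emeasure M {x \<in> space M. t < Y x} \<partial>lborel)"
  proof (rule nn_integral_cong)
    fix t :: real
    have "(\<integral>\<^sup>+x. ennreal (real m * t ^ (m - 1)) * indicator {0<..} t * indicator {..<Y x} t \<partial>M)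
      = (\<integral>\<^sup>+x. ennreal (real m * t ^ (m - 1)) * indicator {0<..} t * indicator {x \<in> space M. t < Y x} x \<partial>M)"
      by (intro nn_integral_cong) (auto split: split_indicator)
    also have "\<dots> = ennreal (real m * t ^ (m - 1)) * indicator {0<..} t * emeasure M {x \<in> space M. t < Y x}"
      by (subst nn_integral_cmult) auto
    finally show "(\<integral>\<^sup>+x. ennreal (real m * t ^ (m - 1)) * indicator {0<..} t * indicator {..<Y x} t \<partial>M)
      = ennreal (real m * t ^ (m - 1)) * indicator {0<..} t * emeasure M {x \<in> space M. t < Y x}" .
  qed
  finally show ?thesis .
qed

text \<open>The tail \<open>exp (- a t\<^sup>d)\<close> belongs to \<open>(E / a)\<^bsup>1/d\<^esup>\<close> with \<open>E\<close> standard exponential. Reading the layer-cake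
formula backwards turns the integral into a moment of this variable, which is Euler's integral
for \<open>\<Gamma>\<close>. This replaces a change of variables.\<close>

lemma nn_integral_power_weibull:
  fixes a :: real
  assumes a: "a > 0" and m: "m \<ge> 1" and d: "d \<ge> 1"
  shows "(\<integral>\<^sup>+t. ennreal (real m * t ^ (m - 1)) * indicator {0<..} t * ennreal (exp (- (a * t ^ d))) \<partial>lborel)
     = ennreal (a powr (- real m / real d) * Gamma (1 + real m / real d))"
proof -
  define E where "E = density lborel (\<lambda>x. ennreal (exponential_density 1 x))"
  interpret E: prob_space E
    unfolding E_def by (rule prob_space_exponential_density) simp
  define Y :: "real \<Rightarrow> real" where "Y x = (max 0 x / a) powr (1 / real d)" for x
  have sets [measurable_cong]: "sets E = sets borel" by (simp add: E_def)
  have space: "space E = UNIV" by (simp add: E_def)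
  have [measurable]: "Y \<in> borel_measurable E" unfolding Y_def by measurable
  have Y0: "0 \<le> Y x" for x by (simp add: Y_def)
  \<comment> \<open>\<open>Y\<close> has the prescribed tail, because \<open>t < Y x\<close> means \<open>a t\<^sup>d < x\<close>\<close>
  have ex: "emeasure E {x \<in> space E. t < Y x} = ennreal (exp (- (a * t ^ d)))" if t: "t > 0" for t
  proof -
    have "t < Y x \<longleftrightarrow> a * t ^ d < x" for x
    proof -
      have "t < Y x \<longleftrightarrow> (t ^ d) powr (1 / real d) < (max 0 x / a) powr (1 / real d)"
        using t d by (simp add: Y_def powr_powr flip: powr_realpow)
      also have "\<dots> \<longleftrightarrow> t ^ d < max 0 x / a"
        proof -
        have "0 \<le> t ^ d" "0 \<le> max 0 x / a" "0 < 1 / real d" using t a d by auto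
        then show ?thesis
          by (meson less_eq_real_def not_le powr_less_mono2 powr_mono2)
      qed
      also have "\<dots> \<longleftrightarrow> a * t ^ d < x"
        using t a by (auto simp: field_simps max_def not_less) (smt (verit) mult_pos_pos zero_less_power)
      finally show ?thesis .
    qed
    then have "{x \<in> space E. t < Y x} = {a * t ^ d<..}" by (auto simp: space)
    also have "emeasure E \<dots> = ennreal (exp (- (a * t ^ d)))"
    proof -
      have "emeasure E {a * t ^ d<..} = ennreal (measure E {x \<in> space E. a * t ^ d < x})"
        by (simp add: E.emeasure_eq_measure space greaterThan_def)
      also have "measure E {x \<in> space E. a * t ^ d < x} = exp (- (a * t ^ d) * 1)"
      proof (rule E.exponential_distributedD_gt)
        show "distributed E lborel (\<lambda>x. x) (\<lambda>x. ennreal (exponential_density 1 x))"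
          unfolding distributed_def E_def by (auto simp: distr_id2)
      qed (use a t in auto)
      finally show ?thesis by simp
    qed
    finally show ?thesis .
  qed
  have "(\<integral>\<^sup>+t. ennreal (real m * t ^ (m - 1)) * indicator {0<..} t * ennreal (exp (- (a * t ^ d))) \<partial>lborel)
     = (\<integral>\<^sup>+t. ennreal (real m * t ^ (m - 1)) * indicator {0<..} t * emeasure E {x \<in> space E. t < Y x} \<partial>lborel)"
    by (intro nn_integral_cong) (auto simp: ex split: split_indicator)
  also have "\<dots> = (\<integral>\<^sup>+x. ennreal (Y x ^ m) \<partial>E)"
    by (intro nn_integral_power_layer_cake [symmetric] m Y0) (auto intro: E.sigma_finite_measure_axioms)
  also have "\<dots> = (\<integral>\<^sup>+x. ennreal (exponential_density 1 x) * ennreal (Y x ^ m) \<partial>lborel)"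
    unfolding E_def by (subst nn_integral_density) (auto simp: Y_def)
  also have "\<dots> = (\<integral>\<^sup>+x. ennreal (a powr (- real m / real d)) *
      ennreal (indicator {0..} x * x powr (1 + real m / real d - 1) / exp x) \<partial>lborel)"
  proof (intro nn_integral_cong_AE)
    show "AE x in lborel. ennreal (exponential_density 1 x) * ennreal (Y x ^ m) =
      ennreal (a powr (- real m / real d)) * ennreal (indicator {0..} x * x powr (1 + real m / real d - 1) / exp x)"
      using AE_lborel_singleton [of 0]
    proof eventually_elim
      case (elim x)
      have "Y x ^ m = a powr (- real m / real d) * x powr (real m / real d)" if "x > 0"
        using that a d by (simp add: Y_def powr_powr powr_divide powr_minus field_simps flip: powr_realpow)
      then show ?case
        using elim by (auto simp: exponential_density_def exp_minus Y0 field_simps split: split_indicator simp flip: ennreal_mult')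
    qed
  qed
  also have "\<dots> = ennreal (a powr (- real m / real d)) * ennreal (Gamma (1 + real m / real d))"
    by (subst nn_integral_cmult, measurable) (subst Gamma_conv_nn_integral_real, auto intro: add_pos_nonneg)
  finally show ?thesis
    by (simp add: ennreal_mult')
qed

section \<open>Samples without close pairs\<close>

text \<open>A probability space with a symmetric closeness relation for which every point has a neighbourhood of
the same probability \<open>p\<close>. Homogeneity is what lets the limiting tail depend on \<open>p\<close> and the sample size alone.\<close>

locale close_pairs = prob_space \<mu> for \<mu> :: "'a measure" +
  fixes K :: "'a \<Rightarrow> 'a \<Rightarrow> bool" and p :: real
  assumes pred_K [measurable]: "Measurable.pred (\<mu> \<Otimes>\<^sub>M \<mu>) (\<lambda>(x, y). K x y)"
    and K_sym: "\<And>x y. x \<in> space \<mu> \<Longrightarrow> y \<in> space \<mu> \<Longrightarrow> K x y \<longleftrightarrow> K y x"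
    and prob_K: "\<And>x. x \<in> space \<mu> \<Longrightarrow> prob {y \<in> space \<mu>. K x y} = p"
begin

(* Index sets are written {1..N}; without this, simplification turns the bound into Suc 0 and
   measurability facts about the sample no longer match. *)
context notes One_nat_def [simp del]
begin

definition nbhd :: "'a \<Rightarrow> 'a set" where
  "nbhd x = {y \<in> space \<mu>. K x y}"

abbreviation sample :: "nat \<Rightarrow> (nat \<Rightarrow> 'a) measure" where
  "sample N \<equiv> \<Pi>\<^sub>M i\<in>{1..N}. \<mu>"

definition avoiding :: "nat \<Rightarrow> (nat \<Rightarrow> 'a) set" where
  "avoiding N = {x \<in> space (sample N). \<forall>j k. 1 \<le> j \<and> j < k \<and> k \<le> N \<longrightarrow> \<not> K (x j) (x k)}"

lemma prob_space_sample: "prob_space (sample N)"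
  by (intro prob_space_PiM prob_space_axioms)

lemma pred_K2 [measurable (raw)]:
  assumes [measurable]: "f \<in> N \<rightarrow>\<^sub>M \<mu>" "g \<in> N \<rightarrow>\<^sub>M \<mu>"
  shows "Measurable.pred N (\<lambda>x. K (f x) (g x))"
proof -
  have "Measurable.pred N (\<lambda>x. (\<lambda>(x, y). K x y) (f x, g x))" by measurable
  then show ?thesis by simp
qed

lemma nbhd_sets [measurable]: "x \<in> space \<mu> \<Longrightarrow> nbhd x \<in> events"
  unfolding nbhd_def by measurable

lemma avoiding_sets [measurable]: "avoiding N \<in> sets (sample N)"
proof -
  have "avoiding N = {x \<in> space (sample N). \<forall>j\<in>{1..N}. \<forall>k\<in>{1..N}. j < k \<longrightarrow> \<not> K (x j) (x k)}"
    unfolding avoiding_def by fastforce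
  also have "\<dots> \<in> sets (sample N)" by measurable
  finally show ?thesis .
qed

lemma sample_space: "x \<in> space (sample N) \<Longrightarrow> i \<in> {1..N} \<Longrightarrow> x i \<in> space \<mu>"
  by (auto simp: space_PiM)

lemma measurable_prob_UN_nbhd [measurable]:
  "(\<lambda>x. prob (\<Union>j\<in>{1..N}. nbhd (x j))) \<in> borel_measurable (sample N)"
proof -
  have "(\<lambda>x. \<integral>\<^sup>+y. indicator {y \<in> space \<mu>. \<exists>j\<in>{1..N}. K (x j) y} y \<partial>\<mu>) \<in> borel_measurable (sample N)"
    unfolding indicator_def mem_Collect_eq by measurable
  then have "(\<lambda>x. enn2real (\<integral>\<^sup>+y. indicator {y \<in> space \<mu>. \<exists>j\<in>{1..N}. K (x j) y} y \<partial>\<mu>)) \<in> borel_measurable (sample N)"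
    by measurable
  also have "?this \<longleftrightarrow> ?thesis"
  proof (rule measurable_cong)
    fix x assume x: "x \<in> space (sample N)"
    have "{y \<in> space \<mu>. \<exists>j\<in>{1..N}. K (x j) y} = (\<Union>j\<in>{1..N}. nbhd (x j))" by (auto simp: nbhd_def)
    moreover have "(\<Union>j\<in>{1..N}. nbhd (x j)) \<in> events"
      using sample_space [OF x] by (intro sets.finite_UN) auto
    ultimately show "enn2real (\<integral>\<^sup>+y. indicator {y \<in> space \<mu>. \<exists>j\<in>{1..N}. K (x j) y} y \<partial>\<mu>)
       = prob (\<Union>j\<in>{1..N}. nbhd (x j))"
      by (simp add: measure_def)
  qed
  finally show ?thesis .
qed

lemma measurable_prob_Int_nbhd [measurable]:
  assumes [measurable]: "i \<in> {1..N}" "k \<in> {1..N}"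
  shows "(\<lambda>x. prob (nbhd (x i) \<inter> nbhd (x k))) \<in> borel_measurable (sample N)"
proof -
  have "(\<lambda>x. \<integral>\<^sup>+y. indicator {y \<in> space \<mu>. K (x i) y \<and> K (x k) y} y \<partial>\<mu>) \<in> borel_measurable (sample N)"
    unfolding indicator_def mem_Collect_eq by measurable
  then have "(\<lambda>x. enn2real (\<integral>\<^sup>+y. indicator {y \<in> space \<mu>. K (x i) y \<and> K (x k) y} y \<partial>\<mu>)) \<in> borel_measurable (sample N)"
    by measurable
  also have "?this \<longleftrightarrow> ?thesis"
  proof (rule measurable_cong)
    fix x assume x: "x \<in> space (sample N)"
    have "{y \<in> space \<mu>. K (x i) y \<and> K (x k) y} = nbhd (x i) \<inter> nbhd (x k)" by (auto simp: nbhd_def)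
    moreover have "nbhd (x i) \<inter> nbhd (x k) \<in> events"
      using sample_space [OF x] assms by auto
    ultimately show "enn2real (\<integral>\<^sup>+y. indicator {y \<in> space \<mu>. K (x i) y \<and> K (x k) y} y \<partial>\<mu>)
       = prob (nbhd (x i) \<inter> nbhd (x k))"
      by (simp add: measure_def)
  qed
  finally show ?thesis .
qed

text \<open>Fubini for the last coordinate: given the first \<open>N\<close> points without a close pair, the new point must fall
outside the union of their neighbourhoods.\<close>

lemma prob_avoiding_Suc:
  "measure (sample (Suc N)) (avoiding (Suc N)) =
    (\<integral>x. indicator (avoiding N) x * (1 - prob (\<Union>j\<in>{1..N}. nbhd (x j))) \<partial>sample N)"
proof -
  interpret P: prob_space "sample N" by (rule prob_space_sample)
  interpret Q: prob_space "sample (Suc N)" by (rule prob_space_sample)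
  interpret product_sigma_finite "\<lambda>_::nat. \<mu>" by standard
  have ins: "{1..Suc N} = insert (Suc N) {1..N}" by auto
  have "emeasure (sample (Suc N)) (avoiding (Suc N)) = (\<integral>\<^sup>+x. indicator (avoiding (Suc N)) x \<partial>sample (Suc N))"
    by simp
  also have "\<dots> = (\<integral>\<^sup>+x. \<integral>\<^sup>+y. indicator (avoiding (Suc N)) (x(Suc N := y)) \<partial>\<mu> \<partial>sample N)"
    unfolding ins by (rule product_nn_integral_insert) (auto simp flip: ins intro!: borel_measurable_indicator)
  also have "\<dots> = (\<integral>\<^sup>+x. ennreal (indicator (avoiding N) x * (1 - prob (\<Union>j\<in>{1..N}. nbhd (x j)))) \<partial>sample N)"
  proof (rule nn_integral_cong)
    fix x assume x: "x \<in> space (sample N)"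
    let ?U = "\<Union>j\<in>{1..N}. nbhd (x j)"
    have U: "?U \<in> events"
      using sample_space [OF x] by (intro sets.finite_UN) auto
    have "(\<integral>\<^sup>+y. indicator (avoiding (Suc N)) (x(Suc N := y)) \<partial>\<mu>) =
      (\<integral>\<^sup>+y. indicator (avoiding N) x * indicator (space \<mu> - ?U) y \<partial>\<mu>)"
    proof (rule nn_integral_cong)
      fix y assume y: "y \<in> space \<mu>"
      have "x(Suc N := y) \<in> space (sample (Suc N))"
        using x y by (auto simp: space_PiM PiE_def extensional_def)
      moreover have "x(Suc N := y) \<in> avoiding (Suc N) \<longleftrightarrow> x \<in> avoiding N \<and> y \<notin> ?U"
        if "x(Suc N := y) \<in> space (sample (Suc N))"
        using that x y unfolding avoiding_def nbhd_def by (auto simp: le_Suc_eq)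
      ultimately show "indicator (avoiding (Suc N)) (x(Suc N := y)) =
         (indicator (avoiding N) x * indicator (space \<mu> - ?U) y :: ennreal)"
        using y by (auto split: split_indicator)
    qed
    also have "\<dots> = indicator (avoiding N) x * emeasure \<mu> (space \<mu> - ?U)"
      using U by (subst nn_integral_cmult) auto
    also have "\<dots> = ennreal (indicator (avoiding N) x * (1 - prob ?U))"
      using prob_compl [OF U] by (auto simp: emeasure_eq_measure split: split_indicator)
    finally show "(\<integral>\<^sup>+y. indicator (avoiding (Suc N)) (x(Suc N := y)) \<partial>\<mu>) =
       ennreal (indicator (avoiding N) x * (1 - prob ?U))" .
  qed
  finally have "ennreal (measure (sample (Suc N)) (avoiding (Suc N))) =
    (\<integral>\<^sup>+x. ennreal (indicator (avoiding N) x * (1 - prob (\<Union>j\<in>{1..N}. nbhd (x j)))) \<partial>sample N)"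
    by (simp add: Q.emeasure_eq_measure)
  then show ?thesis
    by (subst integral_eq_nn_integral) (auto simp: measure_nonneg simp flip: \<open>ennreal _ = _\<close>)
qed

text \<open>Integrate over the new point \<open>y\<close> last: for fixed \<open>y\<close>, the events that the \<open>i\<close>-th and the
\<open>k\<close>-th sample point are close to \<open>y\<close> are independent, and by symmetry each has probability \<open>p\<close>.\<close>

lemma prob_Int_nbhd_expectation:
  assumes i: "i \<in> {1..N}" and k: "k \<in> {1..N}" and ne: "i \<noteq> k"
  shows "(\<integral>x. prob (nbhd (x i) \<inter> nbhd (x k)) \<partial>sample N) = p\<^sup>2"
proof -
  note i [measurable] k [measurable]
  interpret P: prob_space "sample N" by (rule prob_space_sample)
  interpret product_sigma_finite "\<lambda>_::nat. \<mu>" by standard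
  interpret pair_sigma_finite "sample N" \<mu> ..
  have "(\<integral>\<^sup>+x. prob (nbhd (x i) \<inter> nbhd (x k)) \<partial>sample N) =
     (\<integral>\<^sup>+x. \<integral>\<^sup>+y. indicator {y. K (x i) y \<and> K (x k) y} y \<partial>\<mu> \<partial>sample N)"
  proof (rule nn_integral_cong)
    fix x assume x: "x \<in> space (sample N)"
    then have "nbhd (x i) \<inter> nbhd (x k) \<in> events"
      using sample_space [OF x] i k by auto
    then have "ennreal (prob (nbhd (x i) \<inter> nbhd (x k))) = (\<integral>\<^sup>+y. indicator (nbhd (x i) \<inter> nbhd (x k)) y \<partial>\<mu>)"
      by (simp add: emeasure_eq_measure)
    also have "\<dots> = (\<integral>\<^sup>+y. indicator {y. K (x i) y \<and> K (x k) y} y \<partial>\<mu>)"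
      by (intro nn_integral_cong) (auto simp: nbhd_def split: split_indicator)
    finally show "ennreal (prob (nbhd (x i) \<inter> nbhd (x k))) = \<dots>" .
  qed
  also have "\<dots> = (\<integral>\<^sup>+y. \<integral>\<^sup>+x. indicator {y. K (x i) y \<and> K (x k) y} y \<partial>sample N \<partial>\<mu>)"
    by (rule Fubini' [symmetric]) (unfold indicator_def mem_Collect_eq, measurable)
  also have "\<dots> = (\<integral>\<^sup>+y. ennreal (p\<^sup>2) \<partial>\<mu>)"
  proof (rule nn_integral_cong)
    fix y assume y: "y \<in> space \<mu>"
    \<comment> \<open>a product over all coordinates, with trivial factors except at \<open>i\<close> and \<open>k\<close>\<close>
    define f :: "nat \<Rightarrow> 'a \<Rightarrow> ennreal" where
      "f j = (if j = i \<or> j = k then indicator (nbhd y) else (\<lambda>_. 1))" for j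
    have [measurable]: "f j \<in> borel_measurable \<mu>" for j
      using y by (auto simp: f_def)
    have "(\<integral>\<^sup>+x. indicator {y. K (x i) y \<and> K (x k) y} y \<partial>sample N) =
       (\<integral>\<^sup>+x. (\<Prod>j\<in>{1..N}. f j (x j)) \<partial>sample N)"
    proof (rule nn_integral_cong)
      fix x assume x: "x \<in> space (sample N)"
      have "(\<Prod>j\<in>{1..N}. f j (x j)) = (\<Prod>j\<in>{i, k}. f j (x j))"
        by (rule prod.mono_neutral_right) (use i k in \<open>auto simp: f_def\<close>)
      also have "\<dots> = indicator {y. K (x i) y \<and> K (x k) y} y"
        using ne K_sym [OF y sample_space [OF x i]] K_sym [OF y sample_space [OF x k]]
          sample_space [OF x i] sample_space [OF x k]
        by (auto simp: f_def nbhd_def split: split_indicator)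
      finally show "indicator {y. K (x i) y \<and> K (x k) y} y = (\<Prod>j\<in>{1..N}. f j (x j))" ..
    qed
    also have "\<dots> = (\<Prod>j\<in>{1..N}. integral\<^sup>N \<mu> (f j))"
      by (rule product_nn_integral_prod) auto
    also have "\<dots> = (\<Prod>j\<in>{i, k}. integral\<^sup>N \<mu> (f j))"
      by (rule prod.mono_neutral_right) (use i k in \<open>auto simp: f_def emeasure_space_1\<close>)
    also have "\<dots> = ennreal p * ennreal p"
      using ne y prob_K [OF y] by (simp add: f_def emeasure_eq_measure nbhd_def [symmetric])
    also have "\<dots> = ennreal (p\<^sup>2)"
      using prob_K [OF y] measure_nonneg [of \<mu>] by (metis ennreal_mult power2_eq_square)
    finally show "(\<integral>\<^sup>+x. indicator {y. K (x i) y \<and> K (x k) y} y \<partial>sample N) = ennreal (p\<^sup>2)" .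
  qed
  also have "\<dots> = ennreal (p\<^sup>2)" by (simp add: emeasure_space_1)
  finally show ?thesis
    by (subst integral_eq_nn_integral) auto
qed

text \<open>The second Bonferroni inequality.\<close>

lemma prob_UN_ge:
  fixes B :: "nat \<Rightarrow> 'a set"
  assumes "\<And>j. j \<in> {1..n} \<Longrightarrow> B j \<in> events"
  shows "prob (\<Union>j\<in>{1..n}. B j) \<ge> (\<Sum>j=1..n. prob (B j)) - (\<Sum>k=1..n. \<Sum>i\<in>{1..<k}. prob (B i \<inter> B k))"
  using assms
proof (induction n)
  case (Suc n)
  let ?U = "\<Union>j\<in>{1..n}. B j"
  have U: "?U \<in> events" using Suc.prems by (intro sets.finite_UN) auto
  have B: "B (Suc n) \<in> events" using Suc.prems by auto
  have "prob (?U \<inter> B (Suc n)) \<le> (\<Sum>i\<in>{1..n}. prob (B i \<inter> B (Suc n)))"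
  proof -
    have "?U \<inter> B (Suc n) = (\<Union>j\<in>{1..n}. B j \<inter> B (Suc n))" by auto
    then show ?thesis
      using Suc.prems by (simp only:) (intro finite_measure_subadditive_finite, auto)
  qed
  moreover have "prob (?U \<union> B (Suc n)) = prob ?U + prob (B (Suc n)) - prob (?U \<inter> B (Suc n))"
    by (rule measure_Un3) (use U B in \<open>auto simp: fmeasurable_eq_sets\<close>)
  moreover have "(\<Union>j\<in>{1..Suc n}. B j) = ?U \<union> B (Suc n)" by (auto simp: atLeastAtMostSuc_conv)
  ultimately show ?case
    using Suc.IH Suc.prems by (simp add: atLeastLessThanSuc_atLeastAtMost)
qed auto

lemma p_nonneg: "0 \<le> p"
proof -
  obtain x where "x \<in> space \<mu>" using not_empty by blast
  then show ?thesis using prob_K [of x] measure_nonneg [of \<mu>] by metis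
qed

lemma integrable_sample_bounded:
  fixes f :: "(nat \<Rightarrow> 'a) \<Rightarrow> real"
  assumes "f \<in> borel_measurable (sample N)" "\<And>x. x \<in> space (sample N) \<Longrightarrow> \<bar>f x\<bar> \<le> B"
  shows "integrable (sample N) f"
proof -
  interpret P: prob_space "sample N" by (rule prob_space_sample)
  show ?thesis using assms by (intro P.integrable_const_bound [of _ B]) auto
qed

lemma integral_indicator_avoiding:
  "(\<integral>x. indicator (avoiding N) x * c \<partial>sample N) = measure (sample N) (avoiding N) * c"
  by simp

lemma integrable_avoiding_UN: "integrable (sample N)
    (\<lambda>x. indicator (avoiding N) x * (1 - prob (\<Union>j\<in>{1..N}. nbhd (x j))))"
  by (rule integrable_sample_bounded [of _ _ 1]) (auto simp: abs_mult split: split_indicator)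

lemma integrable_avoiding_const: "integrable (sample N) (\<lambda>x. indicator (avoiding N) x * (c::real))"
  by (rule integrable_sample_bounded [of _ _ "\<bar>c\<bar>"]) (auto split: split_indicator)

lemma prob_avoiding_Suc_le_of_UN:
  assumes "\<And>x. x \<in> avoiding N \<Longrightarrow> prob (\<Union>j\<in>{1..N}. nbhd (x j)) \<ge> real N * q"
  shows "measure (sample (Suc N)) (avoiding (Suc N)) \<le> measure (sample N) (avoiding N) * (1 - real N * q)"
proof -
  have "measure (sample (Suc N)) (avoiding (Suc N)) \<le> (\<integral>x. indicator (avoiding N) x * (1 - real N * q) \<partial>sample N)"
    unfolding prob_avoiding_Suc
    by (intro integral_mono integrable_avoiding_UN integrable_avoiding_const)
       (auto simp: assms split: split_indicator)
  then show ?thesis by (simp only: integral_indicator_avoiding)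
qed

lemma prob_avoiding_Suc_ge:
  "measure (sample N) (avoiding N) * (1 - real N * p) \<le> measure (sample (Suc N)) (avoiding (Suc N))"
proof -
  have "(\<integral>x. indicator (avoiding N) x * (1 - real N * p) \<partial>sample N) \<le> measure (sample (Suc N)) (avoiding (Suc N))"
    unfolding prob_avoiding_Suc
  proof (intro integral_mono integrable_avoiding_UN integrable_avoiding_const)
    fix x assume x: "x \<in> space (sample N)"
    have "prob (\<Union>j\<in>{1..N}. nbhd (x j)) \<le> (\<Sum>j=1..N. prob (nbhd (x j)))"
      by (intro finite_measure_subadditive_finite) (use sample_space [OF x] in auto)
    also have "\<dots> = real N * p"
      using sample_space [OF x] prob_K by (simp add: nbhd_def)
    finally show "indicator (avoiding N) x * (1 - real N * p)
        \<le> indicator (avoiding N) x * (1 - prob (\<Union>j\<in>{1..N}. nbhd (x j)))"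
      by (auto split: split_indicator)
  qed
  then show ?thesis by (simp only: integral_indicator_avoiding)
qed

text \<open>By Bonferroni, replacing the probability of the union by \<open>N p\<close> costs at most the sum of the pairwise
intersections. Dropping the condition that the sample avoids close pairs, these have expectation
\<open>p\<^sup>2\<close> each, and there are at most \<open>N\<^sup>2\<close> of them.\<close>

lemma prob_avoiding_Suc_le:
  "measure (sample (Suc N)) (avoiding (Suc N))
     \<le> measure (sample N) (avoiding N) * (1 - real N * p) + (real N)\<^sup>2 * p\<^sup>2"
proof -
  let ?S = "\<lambda>x. \<Sum>k=1..N. \<Sum>i\<in>{1..<k}. prob (nbhd (x i) \<inter> nbhd (x k))"
  have int1: "integrable (sample N) (\<lambda>x. prob (nbhd (x i) \<inter> nbhd (x k)))"
    if "k \<in> {1..N}" "i \<in> {1..<k}" for i k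
    using that by (intro integrable_sample_bounded [of _ _ 1] measurable_prob_Int_nbhd) auto
  have int: "integrable (sample N) ?S"
    by (intro Bochner_Integration.integrable_sum int1)
  have "measure (sample (Suc N)) (avoiding (Suc N)) \<le>
     (\<integral>x. indicator (avoiding N) x * (1 - real N * p) + ?S x \<partial>sample N)"
    unfolding prob_avoiding_Suc
  proof (intro integral_mono integrable_avoiding_UN Bochner_Integration.integrable_add
      integrable_avoiding_const int)
    fix x assume x: "x \<in> space (sample N)"
    have S: "0 \<le> ?S x" by (intro sum_nonneg) auto
    have "(\<Sum>j=1..N. prob (nbhd (x j))) - ?S x \<le> prob (\<Union>j\<in>{1..N}. nbhd (x j))"
      by (intro prob_UN_ge) (use sample_space [OF x] in auto)
    moreover have "(\<Sum>j=1..N. prob (nbhd (x j))) = real N * p"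
      using sample_space [OF x] prob_K by (simp add: nbhd_def)
    ultimately show "indicator (avoiding N) x * (1 - prob (\<Union>j\<in>{1..N}. nbhd (x j)))
       \<le> indicator (avoiding N) x * (1 - real N * p) + ?S x"
      using S by (auto split: split_indicator)
  qed
  also have "\<dots> = (\<integral>x. indicator (avoiding N) x * (1 - real N * p) \<partial>sample N) + (\<integral>x. ?S x \<partial>sample N)"
    by (intro Bochner_Integration.integral_add integrable_avoiding_const int)
  also have "(\<integral>x. indicator (avoiding N) x * (1 - real N * p) \<partial>sample N) = measure (sample N) (avoiding N) * (1 - real N * p)"
    by (rule integral_indicator_avoiding)
  also have "(\<integral>x. ?S x \<partial>sample N) = (\<Sum>k=1..N. \<Sum>i\<in>{1..<k}. p\<^sup>2)"
  proof -
    have "(\<integral>x. ?S x \<partial>sample N) = (\<Sum>k=1..N. \<integral>x. (\<Sum>i\<in>{1..<k}. prob (nbhd (x i) \<inter> nbhd (x k))) \<partial>sample N)"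
      by (intro Bochner_Integration.integral_sum Bochner_Integration.integrable_sum int1)
    also have "\<dots> = (\<Sum>k=1..N. \<Sum>i\<in>{1..<k}. \<integral>x. prob (nbhd (x i) \<inter> nbhd (x k)) \<partial>sample N)"
      by (intro sum.cong refl Bochner_Integration.integral_sum int1)
    also have "\<dots> = (\<Sum>k=1..N. \<Sum>i\<in>{1..<k}. p\<^sup>2)"
      by (intro sum.cong refl prob_Int_nbhd_expectation) auto
    finally show ?thesis .
  qed
  also have "\<dots> \<le> (\<Sum>k=1..N. real N * p\<^sup>2)"
    by (intro sum_mono) (auto intro!: mult_right_mono)
  also have "\<dots> = (real N)\<^sup>2 * p\<^sup>2" by (simp add: power2_eq_square)
  finally show ?thesis by simp
qed

lemma prob_avoiding_0: "measure (sample 0) (avoiding 0) = 1"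
proof -
  interpret P: prob_space "sample 0" by (rule prob_space_sample)
  have "avoiding 0 = space (sample 0)" by (auto simp: avoiding_def)
  then show ?thesis using P.prob_space by simp
qed

lemma prob_avoiding_ge:
  assumes "real N * p \<le> 1"
  shows "(\<Prod>j<N. 1 - real j * p) \<le> measure (sample N) (avoiding N)"
  using assms
proof (induction N)
  case 0 then show ?case by (simp only: prob_avoiding_0) simp
next
  case (Suc N)
  have N: "real N * p \<le> 1" using Suc.prems p_nonneg by (simp add: algebra_simps)
  have "(\<Prod>j<Suc N. 1 - real j * p) \<le> measure (sample N) (avoiding N) * (1 - real N * p)"
    using Suc.IH [OF N] N by (simp add: mult_right_mono)
  also note prob_avoiding_Suc_ge
  finally show ?case .
qed

text \<open>The errors of the \<open>N\<close> steps simply add up, as all later factors \<open>1 - j p\<close> lie in the unit interval.\<close>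

lemma prob_avoiding_le:
  assumes "real N * p \<le> 1"
  shows "measure (sample N) (avoiding N) \<le> (\<Prod>j<N. 1 - real j * p) + real N ^ 3 * p\<^sup>2"
proof -
  have "measure (sample n) (avoiding n) \<le> (\<Prod>j<n. 1 - real j * p) + real n * ((real N)\<^sup>2 * p\<^sup>2)"
    if "n \<le> N" for n using that
  proof (induction n)
    case 0 then show ?case by (simp only: prob_avoiding_0) simp
  next
    case (Suc n)
    have "real n * p \<le> real N * p" using Suc.prems p_nonneg by (intro mult_right_mono) auto
    then have n: "0 \<le> 1 - real n * p" "1 - real n * p \<le> 1" using assms p_nonneg by auto
    have "measure (sample (Suc n)) (avoiding (Suc n))
        \<le> measure (sample n) (avoiding n) * (1 - real n * p) + (real n)\<^sup>2 * p\<^sup>2"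
      by (rule prob_avoiding_Suc_le)
    also have "\<dots> \<le> ((\<Prod>j<n. 1 - real j * p) + real n * ((real N)\<^sup>2 * p\<^sup>2)) * (1 - real n * p) + (real N)\<^sup>2 * p\<^sup>2"
      using Suc n by (intro add_mono mult_right_mono power_mono) auto
    also have "\<dots> \<le> (\<Prod>j<Suc n. 1 - real j * p) + real (Suc n) * ((real N)\<^sup>2 * p\<^sup>2)"
    proof -
      have "real n * ((real N)\<^sup>2 * p\<^sup>2) * (1 - real n * p) \<le> real n * ((real N)\<^sup>2 * p\<^sup>2) * 1"
        using n by (intro mult_left_mono) auto
      then show ?thesis by (simp add: algebra_simps)
    qed
    finally show ?case .
  qed
  from this [of N] show ?thesis by (simp add: power3_eq_cube power2_eq_square mult.assoc)
qed

text \<open>When \<open>N\<^sup>3 p\<^sup>2\<close> is not small, the Bonferroni bound says nothing. This bound covers that range: the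
amount \<open>n q\<close> covered by the neighbourhoods will come from disjoint smaller neighbourhoods.\<close>

lemma prob_avoiding_le_packing:
  assumes UN: "\<And>n x. n < N \<Longrightarrow> x \<in> avoiding n \<Longrightarrow> real n * q \<le> prob (\<Union>j\<in>{1..n}. nbhd (x j))"
  shows "measure (sample N) (avoiding N) \<le> exp (- (real N * (real N - 1) / 2 * q))"
proof -
  have "measure (sample n) (avoiding n) \<le> exp (- ((\<Sum>j<n. real j) * q))" if "n \<le> N" for n using that
  proof (induction n)
    case 0 then show ?case by (simp only: prob_avoiding_0) simp
  next
    case (Suc n)
    have "measure (sample (Suc n)) (avoiding (Suc n)) \<le> measure (sample n) (avoiding n) * (1 - real n * q)"
      using Suc.prems by (intro prob_avoiding_Suc_le_of_UN UN) auto
    also have "\<dots> \<le> measure (sample n) (avoiding n) * exp (- (real n * q))"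
      using exp_ge_add_one_self [of "- (real n * q)"] by (intro mult_left_mono) auto
    also have "\<dots> \<le> exp (- ((\<Sum>j<n. real j) * q)) * exp (- (real n * q))"
      using Suc by (intro mult_right_mono) auto
    also have "\<dots> = exp (- ((\<Sum>j<Suc n. real j) * q))"
      by (simp add: algebra_simps flip: exp_add)
    finally show ?case .
  qed
  from this [of N] show ?thesis by (simp only: sum_real_lessThan order_refl)
qed

end

end

section \<open>Rotations and solid cones\<close>

text \<open>The image measure is translation invariant, and the uniqueness of Haar measure is proved for this
case: for a Borel set \<open>A\<close> and the unit ball \<open>B\<close>, the product of the image measure of \<open>A\<close> and the
volume of \<open>B\<close> is a double integral that Fubini and two translations turn into the volume of \<open>A\<close>
times the image measure of \<open>B\<close>. The map preserves norms, so \<open>B\<close> has the same image measure as volume and cancels.\<close>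

lemma distr_lborel_orthogonal_transformation:
  fixes f :: "'a :: euclidean_space \<Rightarrow> 'a"
  assumes f: "orthogonal_transformation f"
  shows "distr lborel borel f = lborel"
proof (rule measure_eqI)
  have lin: "linear f" using f by (rule orthogonal_transformation_linear)
  have [measurable]: "f \<in> borel_measurable borel"
    by (intro borel_measurable_continuous_onI linear_continuous_on linear_conv_bounded_linear [THEN iffD1] lin)
  have shift: "(\<integral>\<^sup>+u. g (u + c) \<partial>lborel) = (\<integral>\<^sup>+u. g u \<partial>lborel)"
    if [measurable]: "g \<in> borel_measurable borel" for g :: "'a \<Rightarrow> ennreal" and c
    by (subst (2) lborel_distr_plus [of c, symmetric]) (simp add: nn_integral_distr add.commute)
  fix A :: "'a set" assume "A \<in> sets (distr lborel borel f)"
  then have A [measurable]: "A \<in> sets borel" by simp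
  let ?B = "ball 0 1 :: 'a set"
  have [measurable]: "?B \<in> sets borel" by simp
  let ?i = "indicator :: 'a set \<Rightarrow> 'a \<Rightarrow> ennreal"
  have ballf: "emeasure lborel ?B = (\<integral>\<^sup>+u. ?i ?B (- f u) \<partial>lborel)"
    using orthogonal_transformation_norm [OF f]
    by (simp add: indicator_def flip: nn_integral_indicator)
  have fA: "emeasure (distr lborel borel f) A = (\<integral>\<^sup>+u. ?i A (f u) \<partial>lborel)"
    by (simp add: nn_integral_distr flip: nn_integral_indicator)
  have "emeasure (distr lborel borel f) A * emeasure lborel ?B =
     (\<integral>\<^sup>+u. ?i A (f u) * emeasure lborel ?B \<partial>lborel)"
    unfolding fA by (subst nn_integral_multc) auto
  also have "\<dots> = (\<integral>\<^sup>+u. \<integral>\<^sup>+z. ?i A (f u) * ?i ?B (z - f u) \<partial>lborel \<partial>lborel)"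
  proof (rule nn_integral_cong)
    fix u
    have "emeasure lborel ?B = (\<integral>\<^sup>+z. ?i ?B (z + - f u) \<partial>lborel)"
      by (subst shift) (auto intro!: borel_measurable_indicator)
    moreover have "(\<lambda>z. ?i ?B (z - f u)) \<in> borel_measurable lborel" by measurable
    ultimately show "?i A (f u) * emeasure lborel ?B = (\<integral>\<^sup>+z. ?i A (f u) * ?i ?B (z - f u) \<partial>lborel)"
      by (simp add: nn_integral_cmult)
  qed
  also have "\<dots> = (\<integral>\<^sup>+z. \<integral>\<^sup>+u. ?i A (f u) * ?i ?B (z - f u) \<partial>lborel \<partial>lborel)"
    by (rule lborel_pair.Fubini' [symmetric]) measurable
  \<comment> \<open>translate \<open>u\<close> by a preimage of \<open>z\<close>\<close>
  also have "\<dots> = (\<integral>\<^sup>+z. \<integral>\<^sup>+u. ?i A (f u + z) * ?i ?B (- f u) \<partial>lborel \<partial>lborel)"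
  proof (rule nn_integral_cong)
    fix z
    obtain w where w: "f w = z"
      using orthogonal_transformation_surj [OF f] by (metis surj_def)
    have "(\<integral>\<^sup>+u. ?i A (f u) * ?i ?B (z - f u) \<partial>lborel) = (\<integral>\<^sup>+u. ?i A (f (u + w)) * ?i ?B (z - f (u + w)) \<partial>lborel)"
      by (rule shift [symmetric]) measurable
    then show "(\<integral>\<^sup>+u. ?i A (f u) * ?i ?B (z - f u) \<partial>lborel) = (\<integral>\<^sup>+u. ?i A (f u + z) * ?i ?B (- f u) \<partial>lborel)"
      by (simp add: linear_add [OF lin] w)
  qed
  also have "\<dots> = (\<integral>\<^sup>+u. \<integral>\<^sup>+z. ?i A (f u + z) * ?i ?B (- f u) \<partial>lborel \<partial>lborel)"
    by (rule lborel_pair.Fubini') measurable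
  also have "\<dots> = (\<integral>\<^sup>+u. emeasure lborel A * ?i ?B (- f u) \<partial>lborel)"
  proof (rule nn_integral_cong)
    fix u
    have "emeasure lborel A = (\<integral>\<^sup>+z. ?i A (z + f u) \<partial>lborel)"
      by (subst shift) (auto intro!: borel_measurable_indicator)
    then show "(\<integral>\<^sup>+z. ?i A (f u + z) * ?i ?B (- f u) \<partial>lborel) = emeasure lborel A * ?i ?B (- f u)"
      by (subst nn_integral_multc) (auto simp: add.commute)
  qed
  also have "\<dots> = emeasure lborel A * emeasure lborel ?B"
    unfolding ballf by (subst nn_integral_cmult) auto
  finally have "emeasure (distr lborel borel f) A * emeasure lborel ?B / emeasure lborel ?B
      = emeasure lborel A * emeasure lborel ?B / emeasure lborel ?B" by simp
  moreover have "emeasure lborel ?B \<noteq> 0" "emeasure lborel ?B \<noteq> top"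
    using less_imp_neq [OF unit_ball_vol_pos [of "real DIM('a)"]] by (auto simp: emeasure_ball)
  ultimately show "emeasure (distr lborel borel f) A = emeasure lborel A"
    by (simp add: mult_divide_eq_ennreal)
qed simp

text \<open>The slice at height \<open>h\<close> is a \<open>d\<close>-dimensional ball of radius \<open>T h\<close>. Integrating its volume over the
heights gives the volume of a right circular cone with apex at the origin and axis \<open>e\<close>.\<close>

lemma emeasure_lborel_solid_cone:
  fixes e :: "'a :: euclidean_space"
  assumes e: "e \<in> Basis" and T: "T > 0" and H: "H > 0" and d: "DIM('a) = Suc d"
  shows "emeasure lborel {y. 0 < y \<bullet> e \<and> y \<bullet> e \<le> H \<and> norm (y - (y \<bullet> e) *\<^sub>R e) \<le> T * (y \<bullet> e)}
     = ennreal (unit_ball_vol (real d) * T ^ d * H ^ Suc d / Suc d)"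
proof -
  interpret product_sigma_finite "\<lambda>_ :: 'a. lborel :: real measure" by standard
  have coord: "(\<lambda>f. \<Sum>b\<in>Basis. f b *\<^sub>R b :: 'a) \<in> Pi\<^sub>M Basis (\<lambda>_. lborel) \<rightarrow>\<^sub>M borel"
    by measurable
  define B where "B = Basis - {e}"
  have fin: "finite B" and eB: "e \<notin> B" and ins: "Basis = insert e B"
    using e by (auto simp: B_def)
  have cardB: "card B = d" using d e by (simp add: B_def)
  define P where "P f \<longleftrightarrow> 0 < f e \<and> f e \<le> H \<and> sqrt (\<Sum>b\<in>B. (f b)\<^sup>2) \<le> T * f e" for f :: "'a \<Rightarrow> real"
  define S where "S = {f \<in> space (Pi\<^sub>M (insert e B) (\<lambda>_. lborel)). P f}"
  have comp: "(\<lambda>f. f b :: real) \<in> borel_measurable (Pi\<^sub>M I (\<lambda>_. borel))" if "b \<in> I" for b :: 'a and I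
    using measurable_component_singleton [OF that, of "\<lambda>_. borel"] by simp
  have [measurable]: "(\<lambda>f. f e :: real) \<in> borel_measurable (Pi\<^sub>M (insert e B) (\<lambda>_. borel))"
    by (rule comp) simp
  have [measurable]: "(\<lambda>f. \<Sum>b\<in>B. (f b :: real)\<^sup>2) \<in> borel_measurable (Pi\<^sub>M (insert e B) (\<lambda>_. borel))"
    by (intro borel_measurable_sum borel_measurable_power comp) simp
  have [measurable]: "(\<lambda>f. \<Sum>b\<in>B. (f b :: real)\<^sup>2) \<in> borel_measurable (Pi\<^sub>M B (\<lambda>_. borel))"
    by (intro borel_measurable_sum borel_measurable_power comp) simp
  have P [measurable]: "Measurable.pred (Pi\<^sub>M (insert e B) (\<lambda>_. lborel)) P"
  proof -
    have 1 [measurable]: "(\<lambda>f. sqrt (\<Sum>b\<in>B. (f b)\<^sup>2)) \<in> borel_measurable (Pi\<^sub>M (insert e B) (\<lambda>_. borel))"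
      by measurable
    have 2 [measurable]: "(\<lambda>f. T * f e) \<in> borel_measurable (Pi\<^sub>M (insert e B) (\<lambda>_. borel))"
      by measurable
    have 3 [measurable]: "Measurable.pred (Pi\<^sub>M (insert e B) (\<lambda>_. borel)) (\<lambda>f. sqrt (\<Sum>b\<in>B. (f b)\<^sup>2) \<le> T * f e)"
      unfolding pred_def using 1 2 by (rule borel_measurable_le)
    have "Measurable.pred (Pi\<^sub>M (insert e B) (\<lambda>_. borel)) P" unfolding P_def by measurable
    also have "?this \<longleftrightarrow> ?thesis"
      by (intro arg_cong2 [where f = "(\<in>)"] measurable_cong_sets sets_PiM_cong) auto
    finally show ?thesis .
  qed
  have [measurable]: "S \<in> sets (Pi\<^sub>M (insert e B) (\<lambda>_. lborel))"
    unfolding S_def by measurable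
  let ?C = "{y. 0 < y \<bullet> e \<and> y \<bullet> e \<le> H \<and> norm (y - (y \<bullet> e) *\<^sub>R e) \<le> T * (y \<bullet> e)}"
  have C: "?C \<in> sets borel" by measurable
  have "emeasure lborel ?C = emeasure (distr (Pi\<^sub>M Basis (\<lambda>_. lborel)) borel (\<lambda>f. \<Sum>b\<in>Basis. f b *\<^sub>R b)) ?C"
    by (subst lborel_eq) simp
  also have "\<dots> = emeasure (Pi\<^sub>M Basis (\<lambda>_. lborel)) ((\<lambda>f. \<Sum>b\<in>Basis. f b *\<^sub>R b) -` ?C \<inter> space (Pi\<^sub>M Basis (\<lambda>_. lborel)))"
    by (rule emeasure_distr [OF coord]) (use C in simp)
  also have "(\<lambda>f. \<Sum>b\<in>Basis. f b *\<^sub>R b) -` ?C \<inter> space (Pi\<^sub>M Basis (\<lambda>_. lborel)) = S"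
  proof -
    have "(\<Sum>b\<in>Basis. f b *\<^sub>R b) \<in> ?C \<longleftrightarrow> P f" for f :: "'a \<Rightarrow> real"
    proof -
      have 1: "(\<Sum>b\<in>Basis. f b *\<^sub>R b) \<bullet> e = f e" using e by simp
      have "(\<Sum>b\<in>Basis. f b *\<^sub>R b) - f e *\<^sub>R e = (\<Sum>b\<in>B. f b *\<^sub>R b)"
        by (simp add: ins fin eB)
      also have "norm (\<Sum>b\<in>B. f b *\<^sub>R b) = sqrt (\<Sum>b\<in>B. (f b)\<^sup>2)"
      proof -
        have "(norm (\<Sum>b\<in>B. f b *\<^sub>R b))\<^sup>2 = (\<Sum>b\<in>B. (norm (f b *\<^sub>R b))\<^sup>2)"
          by (rule norm_sum_Pythagorean)
             (auto simp: fin pairwise_def orthogonal_def B_def inner_Basis)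
        also have "\<dots> = (\<Sum>b\<in>B. (f b)\<^sup>2)"
          by (intro sum.cong) (auto simp: B_def)
        finally show ?thesis by (intro real_sqrt_unique [symmetric]) auto
      qed
      finally show ?thesis by (simp add: 1 P_def)
    qed
    then show ?thesis by (auto simp: S_def ins [symmetric])
  qed
  also have "emeasure (Pi\<^sub>M Basis (\<lambda>_. lborel)) S = (\<integral>\<^sup>+f. indicator S f \<partial>Pi\<^sub>M (insert e B) (\<lambda>_. lborel))"
    by (simp add: ins)
  also have "\<dots> = (\<integral>\<^sup>+h. \<integral>\<^sup>+f. indicator S (f(e := h)) \<partial>Pi\<^sub>M B (\<lambda>_. lborel) \<partial>lborel)"
    by (rule product_nn_integral_insert_rev) (use fin eB in auto)
  also have "\<dots> = (\<integral>\<^sup>+h. ennreal (unit_ball_vol (real d) * T ^ d * h ^ d) * indicator {0<..H} h \<partial>lborel)"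
  proof (rule nn_integral_cong)
    fix h :: real
    show "(\<integral>\<^sup>+f. indicator S (f(e := h)) \<partial>Pi\<^sub>M B (\<lambda>_. lborel)) =
      ennreal (unit_ball_vol (real d) * T ^ d * h ^ d) * indicator {0<..H} h"
    proof (cases "0 < h \<and> h \<le> H")
      case True
      let ?D = "{f. sqrt (\<Sum>b\<in>B. (f b)\<^sup>2) \<le> T * h} \<inter> space (Pi\<^sub>M B (\<lambda>_. lborel))"
      have "(\<integral>\<^sup>+f. indicator S (f(e := h)) \<partial>Pi\<^sub>M B (\<lambda>_. lborel)) = (\<integral>\<^sup>+f. indicator ?D f \<partial>Pi\<^sub>M B (\<lambda>_. lborel))"
      proof (rule nn_integral_cong)
        fix f assume f: "f \<in> space (Pi\<^sub>M B (\<lambda>_. lborel :: real measure))"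
        have "(\<Sum>b\<in>B. ((f(e := h)) b)\<^sup>2) = (\<Sum>b\<in>B. (f b)\<^sup>2)"
          using eB by (intro sum.cong) auto
        moreover have "f(e := h) \<in> space (Pi\<^sub>M (insert e B) (\<lambda>_. lborel))"
          using f by (auto simp: space_PiM PiE_def extensional_def)
        ultimately have "f(e := h) \<in> S \<longleftrightarrow> f \<in> ?D"
          using True f unfolding S_def P_def by simp
        then show "indicator S (f(e := h)) = (indicator ?D f :: ennreal)"
          by (simp add: indicator_def)
      qed
      also have "\<dots> = emeasure (Pi\<^sub>M B (\<lambda>_. lborel)) ?D"
        by (rule nn_integral_indicator) measurable
      also have "\<dots> = ennreal (unit_ball_vol (real (card B)) * (T * h) ^ card B)"
        using True T by (intro emeasure_cball_aux fin) auto
      finally show ?thesis using True by (simp add: cardB power_mult_distrib mult.assoc)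
    next
      case False
      then have "f(e := h) \<notin> S" for f by (auto simp: S_def P_def)
      then show ?thesis using False by (auto simp: indicator_def)
    qed
  qed
  also have "\<dots> = (\<integral>\<^sup>+h. ennreal (unit_ball_vol (real d) * T ^ d * h ^ d) * indicator {0..H} h \<partial>lborel)"
    using AE_lborel_singleton [of 0]
    by (intro nn_integral_cong_AE, eventually_elim) (auto split: split_indicator)
  also have "\<dots> = unit_ball_vol (real d) * T ^ d * H ^ Suc d / Suc d - unit_ball_vol (real d) * T ^ d * 0 ^ Suc d / Suc d"
    using T H by (intro nn_integral_FTC_Icc) (auto intro!: derivative_eq_intros simp del: power_Suc)
  finally show ?thesis by simp
qed

section \<open>Spherical caps\<close>

definition cap :: "real ^ 'n \<Rightarrow> real \<Rightarrow> (real ^ 'n) set" where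
  "cap x r = {y \<in> sphere 0 1. arccos (x \<bullet> y) \<le> r}"

text \<open>The solid sector over \<open>cap x r\<close>. The angle is bounded through its cosine, which avoids the inverse
function and makes the set visibly Borel and equivariant under rotations.\<close>

definition cap_cone :: "real ^ 'n \<Rightarrow> real \<Rightarrow> (real ^ 'n) set" where
  "cap_cone x r = {y. 0 < norm y \<and> norm y \<le> 1 \<and> norm y * cos r \<le> x \<bullet> y}"

lemma arccos_le_iff:
  assumes "\<bar>t\<bar> \<le> 1" "0 \<le> r" "r \<le> pi"
  shows "arccos t \<le> r \<longleftrightarrow> cos r \<le> t"
  using assms cos_mono_le_eq [of r "arccos t"] arccos_lbound [of t] arccos_ubound [of t]
  by (simp add: cos_arccos_abs abs_le_iff)

lemma inner_sphere_bound:
  assumes "norm x = 1" "norm y = 1"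
  shows "\<bar>x \<bullet> y\<bar> \<le> 1"
  using Cauchy_Schwarz_ineq2 [of x y] assms by simp


lemma cap_eq: "0 \<le> r \<Longrightarrow> r \<le> pi \<Longrightarrow> norm x = 1 \<Longrightarrow> cap x r = {y \<in> sphere 0 1. cos r \<le> x \<bullet> y}"
  unfolding cap_def using inner_sphere_bound [of x] arccos_le_iff by fastforce

lemma emeasure_uniform_sphere_cap:
  fixes x :: "real ^ 'n"
  assumes r: "0 \<le> r" "r \<le> pi" and x: "norm x = 1"
  shows "emeasure uniform_sphere (cap x r) = emeasure lborel (cap_cone x r) / unit_ball_vol CARD('n)"
proof -
  have cone: "emeasure sphere_area A = of_nat CARD('n) * emeasure lborel C"
    if "A \<in> sets borel" "A \<subseteq> sphere 0 1" "\<And>y. y \<in> C \<longleftrightarrow> 0 < norm y \<and> norm y \<le> 1 \<and> sgn y \<in> A"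
    for A C :: "(real ^ 'n) set"
  proof -
    have "{s *\<^sub>R y | s y. 0 < s \<and> s \<le> 1 \<and> y \<in> A} = C"
    proof (intro equalityI subsetI)
      fix z assume "z \<in> {s *\<^sub>R y | s y. 0 < s \<and> s \<le> 1 \<and> y \<in> A}"
      then obtain s y where z: "z = s *\<^sub>R y" "0 < s" "s \<le> 1" "y \<in> A" by blast
      moreover have "norm y = 1" using z that(2) by auto
      ultimately show "z \<in> C" unfolding that(3) by (auto simp: sgn_div_norm)
    next
      fix z assume "z \<in> C"
      then have "z = norm z *\<^sub>R sgn z" "0 < norm z" "norm z \<le> 1" "sgn z \<in> A"
        unfolding that(3) by (auto simp: sgn_div_norm)
      then show "z \<in> {s *\<^sub>R y | s y. 0 < s \<and> s \<le> 1 \<and> y \<in> A}" by blast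
    qed
    then show ?thesis using emeasure_sphere_area [OF that(1,2)] by simp
  qed
  have capb: "cap x r \<in> sets borel"
    using r x by (subst cap_eq) (auto simp: Collect_conj_eq)
  have "emeasure sphere_area (cap x r) = of_nat CARD('n) * emeasure lborel (cap_cone x r)"
  proof (rule cone)
    show "y \<in> cap_cone x r \<longleftrightarrow> 0 < norm y \<and> norm y \<le> 1 \<and> sgn y \<in> cap x r" for y
    proof (cases "y = 0")
      case False
      then have "norm (sgn y) = 1" and sgn: "x \<bullet> sgn y = (x \<bullet> y) / norm y"
        by (auto simp: norm_sgn sgn_div_norm field_simps)
      moreover have "cos r \<le> x \<bullet> sgn y \<longleftrightarrow> norm y * cos r \<le> x \<bullet> y"
        unfolding sgn using False by (simp add: pos_le_divide_eq mult.commute)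
      ultimately show ?thesis using False r x by (auto simp: cap_eq cap_cone_def)
    qed (auto simp: cap_cone_def)
  qed (use capb in \<open>auto simp: cap_def\<close>)
  moreover have "emeasure sphere_area (sphere 0 1 :: (real ^ 'n) set) = of_nat CARD('n) * emeasure lborel (cball 0 1 - {0} :: (real ^ 'n) set)"
    by (rule cone) (auto simp: norm_sgn)
  moreover have "emeasure lborel (cball 0 1 - {0} :: (real ^ 'n) set) = unit_ball_vol CARD('n)"
    by (subst emeasure_Diff) (auto simp: emeasure_cball)
  moreover have "emeasure uniform_sphere (cap x r) = emeasure sphere_area (sphere 0 1 \<inter> cap x r) / emeasure sphere_area (sphere 0 1 :: (real ^ 'n) set)"
    unfolding uniform_sphere_def
    by (rule emeasure_uniform_measure) (use capb in \<open>auto simp: sets_restrict_space_iff cap_def\<close>)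
  moreover have "sphere 0 1 \<inter> cap x r = cap x r" by (auto simp: cap_def)
  ultimately show ?thesis
    using divide_mult_eq [of "of_nat CARD('n)" "emeasure lborel (cap_cone x r)" "ennreal (unit_ball_vol CARD('n))"]
    by (simp add: mult.commute)
qed

lemma cap_cone_sets [measurable]: "cap_cone x r \<in> sets borel"
  unfolding cap_cone_def by measurable

lemma emeasure_cap_cone_rotate:
  fixes x y :: "real ^ 'n"
  assumes "norm x = norm y"
  shows "emeasure lborel (cap_cone x r) = emeasure lborel (cap_cone y r)"
proof -
  obtain f where f: "orthogonal_transformation f" and fx: "f x = y"
    using orthogonal_transformation_exists [OF assms] .
  have lin: "linear f" using f by (rule orthogonal_transformation_linear)
  have [measurable]: "f \<in> borel_measurable borel"
    by (intro borel_measurable_continuous_onI linear_continuous_on linear_conv_bounded_linear [THEN iffD1] lin)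
  have "emeasure lborel (cap_cone y r) = emeasure (distr lborel borel f) (cap_cone y r)"
    by (simp add: distr_lborel_orthogonal_transformation [OF f])
  also have "\<dots> = emeasure lborel (f -` cap_cone y r)"
    by (subst emeasure_distr) auto
  also have "f -` cap_cone y r = cap_cone x r"
    using f unfolding orthogonal_transformation_def cap_cone_def vimage_def mem_Collect_eq
    by (simp only: orthogonal_transformation_norm [OF f] fx [symmetric])
  finally show ?thesis ..
qed

text \<open>Inside the sector of opening angle \<open>r\<close>, the distance from the axis is at most \<open>tan r\<close> times the
height. The sector reaches height \<open>1\<close>, while cutting the cone at height \<open>cos r\<close> keeps it inside the
unit ball.\<close>

lemma cap_cone_sandwich:
  assumes e: "norm e = 1" and r: "0 < r" "r < pi / 2"
  shows "{y. 0 < y \<bullet> e \<and> y \<bullet> e \<le> cos r \<and> norm (y - (y \<bullet> e) *\<^sub>R e) \<le> tan r * (y \<bullet> e)} \<subseteq> cap_cone e r"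
    and "cap_cone e r \<subseteq> {y. 0 < y \<bullet> e \<and> y \<bullet> e \<le> 1 \<and> norm (y - (y \<bullet> e) *\<^sub>R e) \<le> tan r * (y \<bullet> e)}"
proof -
  have cos: "0 < cos r" and tan: "0 < tan r" using r by (auto intro!: cos_gt_zero tan_gt_zero)
  have pyth: "(norm (y - (y \<bullet> e) *\<^sub>R e))\<^sup>2 = (norm y)\<^sup>2 - (y \<bullet> e)\<^sup>2" for y
    using e unfolding power2_norm_eq_inner
    by (simp add: norm_eq_1 power2_eq_square inner_diff_left inner_diff_right inner_commute)
  have key: "norm (y - (y \<bullet> e) *\<^sub>R e) \<le> tan r * (y \<bullet> e) \<longleftrightarrow> norm y * cos r \<le> y \<bullet> e" if "0 < y \<bullet> e" for y
  proof -
    have "norm (y - (y \<bullet> e) *\<^sub>R e) \<le> tan r * (y \<bullet> e) \<longleftrightarrow> (norm (y - (y \<bullet> e) *\<^sub>R e))\<^sup>2 \<le> (tan r * (y \<bullet> e))\<^sup>2"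
      using that tan by (intro power_mono_iff [symmetric]) auto
    also have "\<dots> \<longleftrightarrow> (norm y)\<^sup>2 \<le> (1 + (tan r)\<^sup>2) * (y \<bullet> e)\<^sup>2"
      by (simp add: pyth power_mult_distrib algebra_simps)
    also have "1 + (tan r)\<^sup>2 = inverse ((cos r)\<^sup>2)"
      using cos tan_sec [of r] by (simp add: power_inverse)
    also have "(norm y)\<^sup>2 \<le> inverse ((cos r)\<^sup>2) * (y \<bullet> e)\<^sup>2 \<longleftrightarrow> (norm y * cos r)\<^sup>2 \<le> (y \<bullet> e)\<^sup>2"
      using cos by (simp add: field_simps power_mult_distrib)
    also have "\<dots> \<longleftrightarrow> norm y * cos r \<le> y \<bullet> e"
      using that cos by (intro power_mono_iff) auto
    finally show ?thesis .
  qed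
  show "{y. 0 < y \<bullet> e \<and> y \<bullet> e \<le> cos r \<and> norm (y - (y \<bullet> e) *\<^sub>R e) \<le> tan r * (y \<bullet> e)} \<subseteq> cap_cone e r"
  proof clarify
    fix y assume y: "0 < y \<bullet> e" "y \<bullet> e \<le> cos r" "norm (y - (y \<bullet> e) *\<^sub>R e) \<le> tan r * (y \<bullet> e)"
    then have *: "norm y * cos r \<le> y \<bullet> e" using key by blast
    then have "norm y * cos r \<le> 1 * cos r" using y by linarith
    then have "norm y \<le> 1" using cos by (simp only: mult_le_cancel_right_pos)
    moreover have "0 < norm y" using y by auto
    ultimately show "y \<in> cap_cone e r" using * by (simp add: cap_cone_def inner_commute)
  qed
  show "cap_cone e r \<subseteq> {y. 0 < y \<bullet> e \<and> y \<bullet> e \<le> 1 \<and> norm (y - (y \<bullet> e) *\<^sub>R e) \<le> tan r * (y \<bullet> e)}"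
  proof
    fix y assume "y \<in> cap_cone e r"
    then have y: "0 < norm y" "norm y \<le> 1" "norm y * cos r \<le> y \<bullet> e"
      by (auto simp: cap_cone_def inner_commute)
    then have "0 < y \<bullet> e" using cos by (meson less_le_trans mult_pos_pos)
    moreover have "y \<bullet> e \<le> 1" using norm_cauchy_schwarz [of y e] e y by simp
    ultimately show "y \<in> {y. 0 < y \<bullet> e \<and> y \<bullet> e \<le> 1 \<and> norm (y - (y \<bullet> e) *\<^sub>R e) \<le> tan r * (y \<bullet> e)}"
      using key y by simp
  qed
qed

text \<open>The ratio of the volume of the \<open>d\<close>-dimensional unit ball to the surface area of the unit sphere in
dimension \<open>d + 1\<close>: a small cap is nearly a flat ball.\<close>

lemma kappa_conv_unit_ball_vol:
  assumes "d \<ge> 1"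
  shows "kappa d = unit_ball_vol (real d) / (real (Suc d) * unit_ball_vol (real (Suc d)))"
proof -
  have G: "Gamma (real d / 2 + 1) = real d / 2 * Gamma (real d / 2)"
    using Gamma_plus1 [of "real d / 2"] assms by (force simp: add.commute dest: nonpos_Ints_nonpos)
  have G': "Gamma (real (Suc d) / 2 + 1) = real (Suc d) / 2 * Gamma ((real d + 1) / 2)"
    using Gamma_plus1 [of "real (Suc d) / 2"] by (force simp: add.commute dest: nonpos_Ints_nonpos)
  have pi: "pi powr (real (Suc d) / 2) = pi powr (real d / 2) * sqrt pi"
    by (simp add: add_divide_distrib powr_add powr_half_sqrt)
  have pos: "Gamma (real d / 2) > 0" "Gamma ((real d + 1) / 2) > 0"
    using assms by (auto intro!: Gamma_real_pos)
  show ?thesis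
    using pos assms unfolding kappa_def unit_ball_vol_def G G' pi
    by (simp add: divide_simps)
qed

lemma kappa_pos: "d \<ge> 1 \<Longrightarrow> kappa d > 0"
  by (simp add: kappa_conv_unit_ball_vol)

lemma cap_prob_bounds:
  fixes x :: "real ^ 'n"
  assumes x: "norm x = 1" and r: "0 < r" "r < pi / 2" and n: "CARD('n) = Suc d" and d: "d \<ge> 1"
  shows "measure uniform_sphere (cap x r) \<le> kappa d * tan r ^ d"
    and "measure uniform_sphere (cap x r) \<ge> kappa d * tan r ^ d * cos r ^ Suc d"
proof -
  have cos: "0 < cos r" and tan: "0 < tan r" using r by (auto intro!: cos_gt_zero tan_gt_zero)
  obtain e :: "real ^ 'n" where e: "e \<in> Basis" using nonempty_Basis by blast
  then have ne: "norm e = 1" by simp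
  define v where "v = unit_ball_vol (real (Suc d))"
  have v: "v > 0" by (simp add: v_def)
  have nz: "unit_ball_vol (1 + real d) \<noteq> 0"
    by (rule less_imp_neq [THEN not_sym], rule unit_ball_vol_pos) simp
  have n': "DIM(real ^ 'n) = Suc d" using n by simp
  define C where "C H = {y. 0 < y \<bullet> e \<and> y \<bullet> e \<le> H \<and> norm (y - (y \<bullet> e) *\<^sub>R e) \<le> tan r * (y \<bullet> e)}" for H
  have C: "emeasure lborel (C H) = ennreal (kappa d * tan r ^ d * H ^ Suc d * v)" if "H > 0" for H
    unfolding C_def emeasure_lborel_solid_cone [OF e tan that n'] kappa_conv_unit_ball_vol [OF d]
    using v by (simp add: v_def mult_ac nz)
  have [measurable]: "C H \<in> sets borel" for H unfolding C_def by measurable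
  have k: "kappa d > 0" by (rule kappa_pos [OF d])
  have eq: "emeasure uniform_sphere (cap x r) = emeasure lborel (cap_cone e r) / ennreal v"
    using emeasure_uniform_sphere_cap [of r x] r x emeasure_cap_cone_rotate [of x e] ne n by (simp add: v_def)
  interpret prob_space "uniform_sphere :: (real ^ 'n) measure" by (rule prob_space_uniform_sphere)
  have "ennreal (prob (cap x r)) \<le> emeasure lborel (C 1) / ennreal v"
    unfolding emeasure_eq_measure [symmetric] eq
    using cap_cone_sandwich(2) [OF ne r] by (intro divide_right_mono_ennreal emeasure_mono) (auto simp: C_def)
  also have "\<dots> = ennreal (kappa d * tan r ^ d)"
    using v k tan by (simp add: C divide_ennreal)
  finally show "prob (cap x r) \<le> kappa d * tan r ^ d"
    using k tan by (simp add: ennreal_le_iff)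
  have "ennreal (kappa d * tan r ^ d * cos r ^ Suc d) = emeasure lborel (C (cos r)) / ennreal v"
    using v k tan cos by (simp add: C divide_ennreal)
  also have "\<dots> \<le> ennreal (prob (cap x r))"
    unfolding emeasure_eq_measure [symmetric] eq
    using cap_cone_sandwich(1) [OF ne r] by (intro divide_right_mono_ennreal emeasure_mono) (auto simp: C_def)
  finally show "prob (cap x r) \<ge> kappa d * tan r ^ d * cos r ^ Suc d"
    by (simp add: ennreal_le_iff)
qed

text \<open>A crude form of Jordan's inequality; the constant only affects the constants in the tail bound.\<close>

lemma sin_ge_third:
  fixes x :: real
  assumes "0 \<le> x" "x \<le> pi / 2"
  shows "x / 3 \<le> sin x"
proof -
  have "\<bar>sin x - (\<Sum>m<3. sin_coeff m * x ^ m)\<bar> \<le> inverse (fact 3) * \<bar>x\<bar> ^ 3"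
    by (rule Maclaurin_sin_bound)
  moreover have "(\<Sum>m<3. sin_coeff m * x ^ m) = x"
    by (simp add: numeral_3_eq_3 sin_coeff_def)
  ultimately have "\<bar>sin x - x\<bar> \<le> x ^ 3 / 6"
    using assms by (simp add: fact_numeral)
  then have *: "x - x ^ 3 / 6 \<le> sin x" by linarith
  \<comment> \<open>\<open>x \<le> 2\<close> bounds the cubic term by \<open>2 x / 3\<close>\<close>
  have "x\<^sup>2 \<le> 2\<^sup>2" using assms pi_less_4 by (intro power_mono) auto
  then have "x * x\<^sup>2 \<le> x * 4" using assms by (intro mult_left_mono) auto
  then show ?thesis using * by (simp add: power3_eq_cube power2_eq_square)
qed

lemma geodesic_chord_bounds:
  fixes x y :: "'a :: real_inner"
  assumes "norm x = 1" "norm y = 1"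
  shows "dist x y \<le> arccos (x \<bullet> y)" "arccos (x \<bullet> y) / 3 \<le> dist x y"
proof -
  have b: "-1 \<le> x \<bullet> y" "x \<bullet> y \<le> 1"
    using Cauchy_Schwarz_ineq2 [of x y] assms by auto
  define \<theta> where "\<theta> = arccos (x \<bullet> y)"
  have \<theta>: "0 \<le> \<theta>" "\<theta> \<le> pi" "cos \<theta> = x \<bullet> y"
    using b by (auto simp: \<theta>_def arccos_lbound arccos_ubound)
  have "(dist x y)\<^sup>2 = (2 * sin (\<theta> / 2))\<^sup>2"
  proof -
    have "(dist x y)\<^sup>2 = (norm x)\<^sup>2 + (norm y)\<^sup>2 - 2 * (x \<bullet> y)"
      unfolding dist_norm power2_norm_eq_inner by (simp add: inner_diff_left inner_diff_right inner_commute)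
    also have "\<dots> = 2 - 2 * cos (2 * (\<theta> / 2))"
      using assms \<theta> by simp
    also have "\<dots> = (2 * sin (\<theta> / 2))\<^sup>2"
      unfolding cos_double_sin by (simp add: power2_eq_square)
    finally show ?thesis .
  qed
  then have "dist x y = 2 * sin (\<theta> / 2)"
    using \<theta> by (intro power2_eq_imp_eq [of "dist x y"]) (auto intro!: sin_ge_zero)
  then show "dist x y \<le> arccos (x \<bullet> y)" "arccos (x \<bullet> y) / 3 \<le> dist x y"
    using sin_x_le_x [of "\<theta> / 2"] sin_ge_third [of "\<theta> / 2"] \<theta> by (auto simp: \<theta>_def [symmetric])
qed

text \<open>Comparing with chords replaces the triangle inequality on the sphere: a common point would make the
chord from \<open>x\<close> to \<open>y\<close> at most \<open>r / 3\<close>, whereas the chord is at least a third of the geodesic distance.\<close>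

lemma cap_disjoint:
  fixes x y :: "real ^ 'n"
  assumes "norm x = 1" "norm y = 1" "r < arccos (x \<bullet> y)"
  shows "cap x (r / 6) \<inter> cap y (r / 6) = {}"
proof (rule ccontr)
  assume "cap x (r / 6) \<inter> cap y (r / 6) \<noteq> {}"
  then obtain z where z: "norm z = 1" "arccos (x \<bullet> z) \<le> r / 6" "arccos (y \<bullet> z) \<le> r / 6"
    by (auto simp: cap_def)
  have "arccos (x \<bullet> y) / 3 \<le> dist x y" by (intro geodesic_chord_bounds assms)
  also have "\<dots> \<le> dist x z + dist y z" by (rule dist_triangle2)
  also have "\<dots> \<le> r / 3"
    using geodesic_chord_bounds(1) [of x z] geodesic_chord_bounds(1) [of y z] z assms by simp
  finally show False using assms by simp
qed

text \<open>A bound of the correct order \<open>r\<^sup>d\<close> on a whole interval of radii, which the asymptotics at \<open>0\<close>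
do not provide; the tail bound needs it for all radii up to \<open>\<pi> / 6\<close>.\<close>

lemma cap_prob_lower:
  fixes x :: "real ^ 'n"
  assumes x: "norm x = 1" and r: "0 < r" "r \<le> pi / 3" and n: "CARD('n) = Suc d" and d: "d \<ge> 1"
  shows "kappa d / 2 * (r / 3) ^ d \<le> measure uniform_sphere (cap x r)"
proof -
  have k: "kappa d > 0" by (rule kappa_pos [OF d])
  have c: "1 / 2 \<le> cos r"
    using cos_mono_le_eq [of "pi / 3" r] r by (simp add: cos_60)
  have "kappa d * ((r / 3) ^ d * (1 / 2)) \<le> kappa d * (sin r ^ d * cos r)"
    using k r c sin_ge_third [of r] by (intro mult_left_mono mult_mono power_mono) auto
  also have "\<dots> = kappa d * tan r ^ d * cos r ^ Suc d"
    using c by (simp add: tan_def power_divide)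
  also have "\<dots> \<le> measure uniform_sphere (cap x r)"
    using r by (intro cap_prob_bounds x n d) auto
  finally show ?thesis by simp
qed


lemma cap_prob_asymptotic:
  fixes e :: "real ^ 'n"
  assumes e: "norm e = 1" and n: "CARD('n) = Suc d" and d: "d \<ge> 1"
  shows "((\<lambda>r. measure uniform_sphere (cap e r) / r ^ d) \<longlongrightarrow> kappa d) (at_right 0)"
proof -
  have "((\<lambda>r. tan r / r) \<longlongrightarrow> 1) (at (0::real))"
    using DERIV_tan [of 0] by (simp add: DERIV_def)
  then have tan: "((\<lambda>r. tan r / r) \<longlongrightarrow> 1) (at_right (0::real))"
    by (rule tendsto_mono [OF at_le, rotated]) simp
  have cos: "((\<lambda>r. cos r) \<longlongrightarrow> cos 0) (at_right (0::real))"
    by (intro tendsto_intros)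
  have ev: "\<forall>\<^sub>F r in at_right (0::real). 0 < r \<and> r < pi / 2"
    by (intro eventually_at_right_real [of 0 "pi / 2", THEN eventually_mono]) auto
  show ?thesis
  proof (rule tendsto_sandwich)
    show "\<forall>\<^sub>F r in at_right 0. kappa d * (tan r / r) ^ d * cos r ^ Suc d \<le> measure uniform_sphere (cap e r) / r ^ d"
      using ev
    proof eventually_elim
      case (elim r)
      then show ?case
        using cap_prob_bounds(2) [OF e _ _ n d, of r] by (simp add: power_divide divide_right_mono)
    qed
    show "\<forall>\<^sub>F r in at_right 0. measure uniform_sphere (cap e r) / r ^ d \<le> kappa d * (tan r / r) ^ d"
      using ev
    proof eventually_elim
      case (elim r)
      then show ?case
        using cap_prob_bounds(1) [OF e _ _ n d, of r] by (simp add: power_divide divide_right_mono)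
    qed
    show "((\<lambda>r. kappa d * (tan r / r) ^ d) \<longlongrightarrow> kappa d) (at_right 0)"
      by (rule tendsto_eq_intros tan refl)+ simp
    show "((\<lambda>r. kappa d * (tan r / r) ^ d * cos r ^ Suc d) \<longlongrightarrow> kappa d) (at_right 0)"
      by (rule tendsto_eq_intros tan refl)+ simp
  qed
qed

lemma measurable_uniform_sphere_id [measurable]: "(\<lambda>x. x) \<in> uniform_sphere \<rightarrow>\<^sub>M borel"
proof -
  have "(\<lambda>x. x) \<in> restrict_space borel (sphere 0 1) \<rightarrow>\<^sub>M borel"
    by (rule measurable_restrict_space1) simp
  then show ?thesis by (simp cong: measurable_cong_sets)
qed

lemma borel_measurable_inner_uniform_sphere [measurable (raw)]:
  assumes "f \<in> N \<rightarrow>\<^sub>M (uniform_sphere :: (real ^ 'n) measure)" "g \<in> N \<rightarrow>\<^sub>M (uniform_sphere :: (real ^ 'n) measure)"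
  shows "(\<lambda>x. f x \<bullet> g x) \<in> borel_measurable N"
  by (intro borel_measurable_inner measurable_compose [OF assms(1) measurable_uniform_sphere_id]
      measurable_compose [OF assms(2) measurable_uniform_sphere_id])

text \<open>Inner products of unit vectors stay in the interval where \<open>arccos\<close> is continuous, so clamping the
argument changes nothing.\<close>

lemma borel_measurable_arccos_inner:
  assumes [measurable]: "f \<in> N \<rightarrow>\<^sub>M (uniform_sphere :: (real ^ 'n) measure)" "g \<in> N \<rightarrow>\<^sub>M (uniform_sphere :: (real ^ 'n) measure)"
  shows "(\<lambda>x. arccos (f x \<bullet> g x)) \<in> borel_measurable N"
proof -
  have [measurable]: "(\<lambda>t::real. arccos (max (-1) (min 1 t))) \<in> borel_measurable borel"
    by (intro borel_measurable_continuous_onI continuous_intros) auto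
  have "(\<lambda>x. arccos (max (-1) (min 1 (f x \<bullet> g x)))) \<in> borel_measurable N"
    by measurable
  also have "?this \<longleftrightarrow> ?thesis"
  proof (rule measurable_cong)
    fix x assume "x \<in> space N"
    then have "norm (f x) = 1" "norm (g x) = 1"
      using measurable_space [OF assms(1)] measurable_space [OF assms(2)] by auto
    then have "\<bar>f x \<bullet> g x\<bar> \<le> 1" by (rule inner_sphere_bound)
    then show "arccos (max (-1) (min 1 (f x \<bullet> g x))) = arccos (f x \<bullet> g x)"
      by (auto simp: max_def min_def abs_le_iff)
  qed
  finally show ?thesis .
qed

lemma close_pairs_sphere:
  fixes e :: "real ^ 'n"
  assumes e: "norm e = 1" and r: "0 \<le> r" "r \<le> pi"
  shows "close_pairs uniform_sphere (\<lambda>x y :: real ^ 'n. arccos (x \<bullet> y) \<le> r) (measure uniform_sphere (cap e r))"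
proof -
  interpret prob_space "uniform_sphere :: (real ^ 'n) measure" by (rule prob_space_uniform_sphere)
  show ?thesis
  proof
    have "(\<lambda>p. arccos (fst p \<bullet> snd p)) \<in> borel_measurable (uniform_sphere \<Otimes>\<^sub>M (uniform_sphere :: (real ^ 'n) measure))"
      by (rule borel_measurable_arccos_inner) measurable
    then have "Measurable.pred (uniform_sphere \<Otimes>\<^sub>M (uniform_sphere :: (real ^ 'n) measure)) (\<lambda>p. arccos (fst p \<bullet> snd p :: real) \<le> r)"
      unfolding pred_def by (rule borel_measurable_le) (rule borel_measurable_const)
    then show "Measurable.pred (uniform_sphere \<Otimes>\<^sub>M uniform_sphere) (\<lambda>(x :: real ^ 'n, y). arccos (x \<bullet> y) \<le> r)"
      by (simp add: case_prod_beta')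
  next
    fix x y :: "real ^ 'n"
    show "arccos (x \<bullet> y) \<le> r \<longleftrightarrow> arccos (y \<bullet> x) \<le> r" by (simp add: inner_commute)
  next
    fix x :: "real ^ 'n" assume "x \<in> space uniform_sphere"
    then have x: "norm x = 1" by simp
    have "emeasure uniform_sphere (cap x r) = emeasure uniform_sphere (cap e r)"
      using emeasure_uniform_sphere_cap [OF r x] emeasure_uniform_sphere_cap [OF r e]
        emeasure_cap_cone_rotate [of x e] x e by simp
    moreover have "{y \<in> space uniform_sphere. arccos (x \<bullet> y) \<le> r} = cap x r" by (auto simp: cap_def)
    ultimately show "prob {y \<in> space uniform_sphere. arccos (x \<bullet> y) \<le> r} = prob (cap e r)"
      by (simp add: measure_def)
  qed
qed

section \<open>Separation of a random sample\<close>

lemma finite_separation_set: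
  "finite {arccos (x j \<bullet> x k) | j k. 1 \<le> j \<and> j < k \<and> k \<le> (N::nat)}"
proof -
  have "finite ((\<lambda>(j, k). arccos (x j \<bullet> x k)) ` ({1..N} \<times> {1..N}))" by simp
  then show ?thesis by (rule rev_finite_subset) force
qed

lemma less_separation_iff:
  assumes "N \<ge> 2"
  shows "t < separation N x \<longleftrightarrow> (\<forall>j k. 1 \<le> j \<and> j < k \<and> k \<le> N \<longrightarrow> t < arccos (x j \<bullet> x k))"
proof -
  have "arccos (x 1 \<bullet> x 2) \<in> {arccos (x j \<bullet> x k) | j k. 1 \<le> j \<and> j < k \<and> k \<le> N}"
    using assms by force
  then show ?thesis
    unfolding separation_def by (subst Min_gr_iff [OF finite_separation_set]) auto
qed

lemma separation_mem:
  assumes "N \<ge> 2"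
  shows "\<exists>j k. 1 \<le> j \<and> j < k \<and> k \<le> N \<and> separation N x = arccos (x j \<bullet> x k)"
proof -
  have "arccos (x 1 \<bullet> x 2) \<in> {arccos (x j \<bullet> x k) | j k. 1 \<le> j \<and> j < k \<and> k \<le> N}"
    using assms by force
  then have "separation N x \<in> {arccos (x j \<bullet> x k) | j k. 1 \<le> j \<and> j < k \<and> k \<le> N}"
    unfolding separation_def by (intro Min_in finite_separation_set) auto
  then show ?thesis by blast
qed

abbreviation sphere_sample :: "nat \<Rightarrow> (nat \<Rightarrow> real ^ 'n) measure" where
  "sphere_sample N \<equiv> \<Pi>\<^sub>M i\<in>{1..N}. uniform_sphere"

lemma separation_bounds:
  fixes x :: "nat \<Rightarrow> real ^ 'n"
  assumes "N \<ge> 2" "x \<in> space (sphere_sample N)"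
  shows "0 \<le> separation N x" "separation N x \<le> pi"
proof -
  obtain j k where jk: "1 \<le> j" "j < k" "k \<le> N" "separation N x = arccos (x j \<bullet> x k)"
    using separation_mem [OF assms(1)] by blast
  have "norm (x j) = 1" "norm (x k) = 1"
    using assms(2) jk by (auto simp: space_PiM PiE_iff)
  then have "\<bar>x j \<bullet> x k\<bar> \<le> 1" by (rule inner_sphere_bound)
  then show "0 \<le> separation N x" "separation N x \<le> pi"
    by (auto simp: jk abs_le_iff arccos_lbound arccos_ubound)
qed

lemma borel_measurable_separation:
  assumes N: "N \<ge> 2"
  shows "separation N \<in> borel_measurable (sphere_sample N :: (nat \<Rightarrow> real ^ 'n) measure)"
proof (rule borel_measurable_iff_greater [THEN iffD2], rule allI)
  fix a :: real
  let ?S = "sphere_sample N :: (nat \<Rightarrow> real ^ 'n) measure"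
  have [measurable]: "(\<lambda>x. arccos (x j \<bullet> x k)) \<in> borel_measurable ?S" if "j \<in> {1..N}" "k \<in> {1..N}" for j k
    by (rule borel_measurable_arccos_inner) (use that in measurable)
  have "{x \<in> space ?S. a < separation N x} =
     {x \<in> space ?S. \<forall>j\<in>{1..N}. \<forall>k\<in>{1..N}. j < k \<longrightarrow> a < arccos (x j \<bullet> x k)}"
    unfolding less_separation_iff [OF N] by fastforce
  also have "\<dots> \<in> sets ?S" by measurable
  finally show "{x \<in> space ?S. a < separation N x} \<in> sets ?S" .
qed

lemma separation_gt_eq_avoiding:
  fixes e :: "real ^ 'n"
  assumes e: "norm e = 1" and r: "0 \<le> r" "r \<le> pi" and N: "N \<ge> 2"
  shows "{x \<in> space (sphere_sample N). r < separation N x} =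
    close_pairs.avoiding uniform_sphere (\<lambda>x y :: real ^ 'n. arccos (x \<bullet> y) \<le> r) N"
  unfolding close_pairs.avoiding_def [OF close_pairs_sphere [OF e r]] less_separation_iff [OF N]
  by (simp add: not_le)

lemma scaled_radius_power:
  assumes "N \<ge> 1" "t > 0" "d \<ge> 1"
  shows "(real N)\<^sup>2 * (t * real N powr (- 2 / real d)) ^ d = t ^ d"
proof -
  have "(real N powr (- 2 / real d)) ^ d = real N powr (- 2)"
    using assms by (subst powr_realpow [symmetric]) (auto simp: powr_powr)
  also have "\<dots> = inverse ((real N)\<^sup>2)"
    using assms by (simp add: powr_minus powr_numeral)
  finally show ?thesis using assms by (simp add: power_mult_distrib field_simps)
qed

lemma scaled_separation_less_iff:
  assumes "N \<ge> 1"
  shows "t < real N powr (2 / real d) * s \<longleftrightarrow> t * real N powr (- 2 / real d) < s"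
  using assms by (simp add: powr_minus field_simps)

text \<open>For radii \<open>r \<le> \<pi>\<close> the disjoint caps of radius \<open>r / 6\<close> supply the packing hypothesis, and
\<open>N (N - 1) / 2 \<ge> N\<^sup>2 / 4\<close>. For larger \<open>r\<close> the tail vanishes because geodesic distances are at most
\<open>\<pi>\<close>.\<close>

lemma separation_tail_le:
  assumes n: "CARD('n) = Suc d" and d: "d \<ge> 1" and N: "N \<ge> 2" and t: "t > 0"
  defines "c \<equiv> kappa d / (8 * 18 ^ d)"
  shows "measure (sphere_sample N) {x \<in> space (sphere_sample N :: (nat \<Rightarrow> real ^ 'n) measure).
      t < real N powr (2 / real d) * separation N x} \<le> exp (- (c * t ^ d))"
proof -
  define r where "r = t * real N powr (- 2 / real d)"
  have r0: "r > 0" using t N by (simp add: r_def)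
  have rd: "(real N)\<^sup>2 * r ^ d = t ^ d"
    unfolding r_def by (rule scaled_radius_power) (use t N d in auto)
  have set: "{x \<in> space (sphere_sample N :: (nat \<Rightarrow> real ^ 'n) measure). t < real N powr (2 / real d) * separation N x}
      = {x \<in> space (sphere_sample N). r < separation N x}"
    using N by (simp add: scaled_separation_less_iff r_def)
  have k: "kappa d > 0" by (rule kappa_pos [OF d])
  show ?thesis
  proof (cases "r \<le> pi")
    case False
    then have empty: "{x \<in> space (sphere_sample N :: (nat \<Rightarrow> real ^ 'n) measure). r < separation N x} = {}"
      using separation_bounds(2) [OF N] by (force simp: not_le)
    show ?thesis unfolding set empty by simp
  next
    case True
    obtain e :: "real ^ 'n" where "e \<in> Basis" using nonempty_Basis by blast
    then have e: "norm e = 1" by simp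
    interpret close_pairs "uniform_sphere :: (real ^ 'n) measure" "\<lambda>x y. arccos (x \<bullet> y) \<le> r" "measure uniform_sphere (cap e r)"
      using r0 True by (intro close_pairs_sphere e) auto
    \<comment> \<open>a lower bound for the area of a cap of radius \<open>r / 6\<close>\<close>
    define q where "q = kappa d / 2 * (r / 18) ^ d"
    have q0: "0 \<le> q" using k r0 by (simp add: q_def)
    have "measure (sphere_sample N) (avoiding N) \<le> exp (- (real N * (real N - 1) / 2 * q))"
    proof (rule prob_avoiding_le_packing)
      fix m and x :: "nat \<Rightarrow> real ^ 'n" assume x: "x \<in> avoiding m"
      then have xs: "norm (x j) = 1" if "j \<in> {1..m}" for j
        using that by (auto simp: avoiding_def space_PiM PiE_iff)
      have ev: "cap (x j) (r / 6) \<in> events" if "j \<in> {1..m}" for j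
      proof -
        have "cap (x j) (r / 6) = {y \<in> space uniform_sphere. arccos (x j \<bullet> y) \<le> r / 6}"
          by (auto simp: cap_def)
        also have "\<dots> \<in> events"
          using xs [OF that] by (intro borel_measurable_le borel_measurable_arccos_inner) auto
        finally show ?thesis .
      qed
      have "real m * q \<le> (\<Sum>j\<in>{1..m}. prob (cap (x j) (r / 6)))"
      proof -
        have "(\<Sum>j\<in>{1..m}. q) \<le> (\<Sum>j\<in>{1..m}. prob (cap (x j) (r / 6)))"
        proof (rule sum_mono)
          fix j assume "j \<in> {1..m}"
          then show "q \<le> prob (cap (x j) (r / 6))"
            using cap_prob_lower [OF xs _ _ n d, of j "r / 6"] r0 True by (simp add: q_def)
        qed
        then show ?thesis by simp
      qed
      also have "\<dots> = prob (\<Union>j\<in>{1..m}. cap (x j) (r / 6))"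
      proof (rule finite_measure_finite_Union [symmetric])
        show "disjoint_family_on (\<lambda>j. cap (x j) (r / 6)) {1..m}"
          unfolding disjoint_family_on_def
        proof (intro ballI impI)
          fix i j assume ij: "i \<in> {1..m}" "j \<in> {1..m}" "i \<noteq> j"
          have less: "r < arccos (x a \<bullet> x b)" if "a \<in> {1..m}" "b \<in> {1..m}" "a < b" for a b
            using x that by (auto simp: avoiding_def not_le)
          have "r < arccos (x i \<bullet> x j)"
            using less [OF ij(1,2)] less [OF ij(2,1)] ij(3) by (metis inner_commute linorder_neqE_nat)
          then show "cap (x i) (r / 6) \<inter> cap (x j) (r / 6) = {}"
            using ij xs by (intro cap_disjoint) auto
        qed
      qed (use ev in auto)
      also have "\<dots> \<le> prob (\<Union>j\<in>{1..m}. nbhd (x j))"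
      proof (rule finite_measure_mono)
        show "(\<Union>j\<in>{1..m}. cap (x j) (r / 6)) \<subseteq> (\<Union>j\<in>{1..m}. nbhd (x j))"
          using r0 by (fastforce simp: cap_def nbhd_def)
        show "(\<Union>j\<in>{1..m}. nbhd (x j)) \<in> events"
          using xs by (intro sets.finite_UN nbhd_sets) auto
      qed
      finally show "real m * q \<le> prob (\<Union>j\<in>{1..m}. nbhd (x j))" .
    qed
    also have "\<dots> \<le> exp (- (c * t ^ d))"
    proof -
      have "real N * 2 \<le> real N * real N" using N by (intro mult_left_mono) auto
      then have "(real N)\<^sup>2 / 4 \<le> real N * (real N - 1) / 2"
        by (simp add: power2_eq_square algebra_simps)
      then have "(real N)\<^sup>2 / 4 * q \<le> real N * (real N - 1) / 2 * q"
        using q0 by (rule mult_right_mono)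
      moreover have "(real N)\<^sup>2 / 4 * q = c * t ^ d"
        unfolding rd [symmetric] q_def c_def by (simp add: power_divide)
      ultimately have "c * t ^ d \<le> real N * (real N - 1) / 2 * q" by (simp only:)
      then show ?thesis by (simp only: exp_le_cancel_iff neg_le_iff_le)
    qed
    finally show ?thesis
      unfolding set using separation_gt_eq_avoiding [OF e _ True N] r0 by simp
  qed
qed

text \<open>With \<open>p\<close> the cap area at radius \<open>t N\<^bsup>-2/d\<^esup>\<close>, the cap asymptotics give \<open>N\<^sup>2 p \<longlongrightarrow> \<kappa>\<^sub>d t\<^sup>d\<close>. This determines the
limit of the products, and it makes \<open>N p\<close> and the error \<open>N\<^sup>3 p\<^sup>2\<close> of order \<open>1 / N\<close>.\<close>

lemma separation_tail_tendsto:
  assumes n: "CARD('n) = Suc d" and d: "d \<ge> 1" and t: "t > 0"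
  shows "(\<lambda>N. measure (sphere_sample N) {x \<in> space (sphere_sample N :: (nat \<Rightarrow> real ^ 'n) measure).
      t < real N powr (2 / real d) * separation N x}) \<longlonglongrightarrow> exp (- (kappa d / 2 * t ^ d))"
proof -
  obtain e :: "real ^ 'n" where "e \<in> Basis" using nonempty_Basis by blast
  then have e: "norm e = 1" by simp
  define r where "r N = t * real N powr (- 2 / real d)" for N
  define p where "p N = measure uniform_sphere (cap e (r N))" for N
  define L where "L N = (\<Prod>j<N. 1 - real j * p N)" for N
  have p0: "0 \<le> p N" for N by (simp add: p_def)
  have r_pos: "\<forall>\<^sub>F N in sequentially. r N > 0"
    using eventually_gt_at_top [of 0] by eventually_elim (use t in \<open>simp add: r_def\<close>)
  have "(\<lambda>N. t * real N powr (- 2 / real d)) \<longlonglongrightarrow> t * 0"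
    using d by (intro tendsto_mult tendsto_const tendsto_neg_powr filterlim_real_sequentially) auto
  then have r0: "r \<longlonglongrightarrow> 0" by (simp add: r_def [abs_def])
  have r_right: "filterlim r (at_right 0) sequentially"
    unfolding filterlim_at using r0 r_pos by (auto elim: eventually_mono)
  have r_pi: "\<forall>\<^sub>F N in sequentially. r N < pi"
    using r0 by (rule order_tendstoD) simp
  have "(\<lambda>N. p N / r N ^ d * t ^ d) \<longlonglongrightarrow> kappa d * t ^ d"
    unfolding p_def
    by (intro tendsto_mult tendsto_const filterlim_compose [OF cap_prob_asymptotic [OF e n d] r_right])
  then have p_lim: "(\<lambda>N. (real N)\<^sup>2 * p N) \<longlonglongrightarrow> kappa d * t ^ d"
  proof (rule Lim_transform_eventually)
    show "\<forall>\<^sub>F N in sequentially. p N / r N ^ d * t ^ d = (real N)\<^sup>2 * p N"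
      using r_pos eventually_ge_at_top [of 1]
    proof eventually_elim
      case (elim N)
      then have "(real N)\<^sup>2 * r N ^ d = t ^ d"
        unfolding r_def by (intro scaled_radius_power) (use t d in auto)
      then show ?case using elim by (simp add: field_simps)
    qed
  qed
  have L: "L \<longlonglongrightarrow> exp (- (kappa d / 2 * t ^ d))"
    using prod_one_minus_tendsto [OF p0 p_lim] by (simp add: L_def [abs_def])
  have inv: "(\<lambda>N. 1 / real N) \<longlonglongrightarrow> 0" by (rule lim_1_over_n)
  have "(\<lambda>N. (real N)\<^sup>2 * p N * (1 / real N)) \<longlonglongrightarrow> kappa d * t ^ d * 0"
    by (intro tendsto_mult p_lim inv)
  then have "(\<lambda>N. (real N)\<^sup>2 * p N * (1 / real N)) \<longlonglongrightarrow> 0" by simp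
  then have Np: "\<forall>\<^sub>F N in sequentially. (real N)\<^sup>2 * p N * (1 / real N) < 1"
    by (rule order_tendstoD) simp
  have "(\<lambda>N. ((real N)\<^sup>2 * p N)\<^sup>2 * (1 / real N)) \<longlonglongrightarrow> (kappa d * t ^ d)\<^sup>2 * 0"
    by (intro tendsto_intros p_lim inv)
  then have err: "(\<lambda>N. real N ^ 3 * (p N)\<^sup>2) \<longlonglongrightarrow> 0"
  proof (rule Lim_transform_eventually [OF tendsto_eq_rhs])
    show "\<forall>\<^sub>F N in sequentially. ((real N)\<^sup>2 * p N)\<^sup>2 * (1 / real N) = real N ^ 3 * (p N)\<^sup>2"
      using eventually_gt_at_top [of 0]
      by eventually_elim (simp add: power2_eq_square power3_eq_cube field_simps)
  qed simp
  let ?G = "\<lambda>N. measure (sphere_sample N) {x \<in> space (sphere_sample N :: (nat \<Rightarrow> real ^ 'n) measure).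
      t < real N powr (2 / real d) * separation N x}"
  have bounds: "\<forall>\<^sub>F N in sequentially. L N \<le> ?G N \<and> ?G N \<le> L N + real N ^ 3 * (p N)\<^sup>2"
    using r_pos r_pi Np eventually_ge_at_top [of 2]
  proof eventually_elim
    case (elim N)
    interpret close_pairs "uniform_sphere :: (real ^ 'n) measure" "\<lambda>x y. arccos (x \<bullet> y) \<le> r N" "p N"
      unfolding p_def using elim by (intro close_pairs_sphere e) auto
    have "real N * p N \<le> 1" using elim by (simp add: power2_eq_square)
    moreover have "{x \<in> space (sphere_sample N :: (nat \<Rightarrow> real ^ 'n) measure). t < real N powr (2 / real d) * separation N x}
        = avoiding N"
      using elim separation_gt_eq_avoiding [OF e, of "r N" N]
      by (simp add: scaled_separation_less_iff r_def)
    ultimately show ?case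
      using prob_avoiding_ge [of N] prob_avoiding_le [of N] by (simp add: L_def)
  qed
  show ?thesis
  proof (rule tendsto_sandwich)
    show "\<forall>\<^sub>F N in sequentially. L N \<le> ?G N" using bounds by eventually_elim simp
    show "\<forall>\<^sub>F N in sequentially. ?G N \<le> L N + real N ^ 3 * (p N)\<^sup>2" using bounds by eventually_elim simp
    show "(\<lambda>N. L N + real N ^ 3 * (p N)\<^sup>2) \<longlonglongrightarrow> exp (- (kappa d / 2 * t ^ d))"
      using tendsto_add [OF L err] by simp
  qed (rule L)
qed


text \<open>Dominated convergence in the layer-cake formula. The sequence is shifted by two since the separation is
meaningful only for at least two points.\<close>

lemma separation_moment_tendsto:
  assumes n: "CARD('n) = Suc d" and d: "d \<ge> 1" and m: "m \<ge> 1"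
  shows "(\<lambda>N. \<integral>x. (real N powr (2 / real d) * separation N x) ^ m \<partial>(sphere_sample N :: (nat \<Rightarrow> real ^ 'n) measure))
    \<longlonglongrightarrow> (kappa d / 2) powr (- real m / real d) * Gamma (1 + real m / real d)"
proof -
  define S where "S N = (sphere_sample N :: (nat \<Rightarrow> real ^ 'n) measure)" for N
  define Y where "Y N x = real N powr (2 / real d) * separation N x" for N and x :: "nat \<Rightarrow> real ^ 'n"
  define G where "G N t = emeasure (S N) {x \<in> space (S N). t < Y N x}" for N t
  define w :: "real \<Rightarrow> ennreal" where "w t = ennreal (real m * t ^ (m - 1)) * indicator {0<..} t" for t
  define c where "c = kappa d / (8 * 18 ^ d)"
  define l where "l = (kappa d / 2) powr (- real m / real d) * Gamma (1 + real m / real d)"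
  have c0: "c > 0" using kappa_pos [OF d] by (simp add: c_def)
  have prob: "prob_space (S N)" for N
    unfolding S_def by (intro prob_space_PiM prob_space_uniform_sphere)
  have Ym: "Y (N + 2) \<in> borel_measurable (S (N + 2))" for N
    unfolding Y_def S_def by (intro borel_measurable_times borel_measurable_const borel_measurable_separation) simp
  have Y0: "0 \<le> Y (N + 2) x" if "x \<in> space (S (N + 2))" for N x
    unfolding Y_def using that separation_bounds(1) [of "N + 2" x] by (simp add: S_def)
  have w [measurable]: "w \<in> borel_measurable lborel" unfolding w_def by measurable
  have Gm [measurable]: "G (N + 2) \<in> borel_measurable lborel" for N
  proof -
    interpret P: prob_space "S (N + 2)" by (rule prob)
    note Ym [of N, measurable]
    have "(\<lambda>t. \<integral>\<^sup>+x. indicator {x \<in> space (S (N + 2)). t < Y (N + 2) x} x \<partial>S (N + 2)) \<in> borel_measurable lborel"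
      unfolding indicator_def mem_Collect_eq by measurable
    also have "(\<lambda>t. \<integral>\<^sup>+x. indicator {x \<in> space (S (N + 2)). t < Y (N + 2) x} x \<partial>S (N + 2)) = G (N + 2)"
      unfolding G_def by (intro ext nn_integral_indicator) measurable
    finally show ?thesis .
  qed
  have G_eq: "G N t = ennreal (measure (S N) {x \<in> space (S N). t < Y N x})" for N t
    unfolding G_def using prob [of N] by (simp add: finite_measure.emeasure_eq_measure prob_space.finite_measure)
  have tail: "(\<integral>\<^sup>+x. ennreal (Y (N + 2) x ^ m) \<partial>S (N + 2)) = (\<integral>\<^sup>+t. w t * G (N + 2) t \<partial>lborel)" for N
  proof -
    interpret P: prob_space "S (N + 2)" by (rule prob)
    show ?thesis
      unfolding w_def G_def
      by (rule nn_integral_power_layer_cake [OF P.sigma_finite_measure_axioms Ym Y0 m])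
  qed
  have weibull: "(\<integral>\<^sup>+t. w t * ennreal (exp (- (a * t ^ d))) \<partial>lborel) =
      ennreal (a powr (- real m / real d) * Gamma (1 + real m / real d))" if "a > 0" for a
    unfolding w_def by (rule nn_integral_power_weibull [OF that m d])
  have "(\<lambda>N. \<integral>\<^sup>+t. w t * G (N + 2) t \<partial>lborel) \<longlonglongrightarrow> (\<integral>\<^sup>+t. w t * ennreal (exp (- (kappa d / 2 * t ^ d))) \<partial>lborel)"
  proof (rule nn_integral_dominated_convergence [where w = "\<lambda>t. w t * ennreal (exp (- (c * t ^ d)))"])
    show "AE t in lborel. w t * G (N + 2) t \<le> w t * ennreal (exp (- (c * t ^ d)))" for N
    proof (rule AE_I2)
      fix t :: real
      show "w t * G (N + 2) t \<le> w t * ennreal (exp (- (c * t ^ d)))"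
      proof (cases "t > 0")
        case True
        then have "G (N + 2) t \<le> ennreal (exp (- (c * t ^ d)))"
          unfolding G_eq S_def Y_def c_def by (intro ennreal_leI separation_tail_le n d) auto
        then show ?thesis by (rule mult_left_mono) simp
      qed (simp add: w_def)
    qed
    show "(\<integral>\<^sup>+t. w t * ennreal (exp (- (c * t ^ d))) \<partial>lborel) < \<infinity>"
      using weibull [OF c0] by simp
    show "AE t in lborel. (\<lambda>N. w t * G (N + 2) t) \<longlonglongrightarrow> w t * ennreal (exp (- (kappa d / 2 * t ^ d)))"
    proof (rule AE_I2)
      fix t :: real
      show "(\<lambda>N. w t * G (N + 2) t) \<longlonglongrightarrow> w t * ennreal (exp (- (kappa d / 2 * t ^ d)))"
      proof (cases "t > 0")
        case True
        have "(\<lambda>N. G N t) \<longlonglongrightarrow> ennreal (exp (- (kappa d / 2 * t ^ d)))"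
          unfolding G_eq S_def Y_def by (intro tendsto_ennrealI separation_tail_tendsto n d True)
        then have "(\<lambda>N. G (N + 2) t) \<longlonglongrightarrow> ennreal (exp (- (kappa d / 2 * t ^ d)))"
          by (rule LIMSEQ_ignore_initial_segment)
        then show ?thesis
          by (rule ennreal_tendsto_cmult [rotated]) (simp add: w_def ennreal_mult_less_top split: split_indicator)
      qed (simp add: w_def)
    qed
  qed measurable
  also have "(\<integral>\<^sup>+t. w t * ennreal (exp (- (kappa d / 2 * t ^ d))) \<partial>lborel) = ennreal l"
    unfolding l_def using kappa_pos [OF d] by (intro weibull) simp
  finally have "(\<lambda>N. enn2real (\<integral>\<^sup>+t. w t * G (N + 2) t \<partial>lborel)) \<longlonglongrightarrow> l"
  proof (rule tendsto_enn2real)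
    have "0 < 1 + real m / real d" by (intro add_pos_nonneg) auto
    then show "0 \<le> l" unfolding l_def by (intro mult_nonneg_nonneg less_imp_le [OF Gamma_real_pos]) auto
  qed
  also have "(\<lambda>N. enn2real (\<integral>\<^sup>+t. w t * G (N + 2) t \<partial>lborel)) = (\<lambda>N. \<integral>x. Y (N + 2) x ^ m \<partial>S (N + 2))"
  proof (rule ext)
    fix N
    show "enn2real (\<integral>\<^sup>+t. w t * G (N + 2) t \<partial>lborel) = (\<integral>x. Y (N + 2) x ^ m \<partial>S (N + 2))"
      unfolding tail [symmetric]
      by (rule integral_eq_nn_integral [symmetric]) (use Ym [of N] Y0 [of _ N] in auto)
  qed
  finally have "(\<lambda>N. \<integral>x. Y N x ^ m \<partial>S N) \<longlonglongrightarrow> l"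
    by (rule LIMSEQ_offset)
  then show ?thesis by (simp only: Y_def S_def l_def)
qed

lemma separation_restrict: "separation N (restrict x {1..N}) = separation N x"
proof -
  have "{arccos (restrict x {1..N} j \<bullet> restrict x {1..N} k) | j k. 1 \<le> j \<and> j < k \<and> k \<le> N} =
        {arccos (x j \<bullet> x k) | j k. 1 \<le> j \<and> j < k \<and> k \<le> N}"
    by (intro Collect_cong ex_cong1) (auto simp: restrict_def)
  then show ?thesis by (simp add: separation_def)
qed

theorem corollary3p4:
  fixes d :: nat
    and M :: "nat \<Rightarrow> 'w measure"
    and X :: "nat \<Rightarrow> nat \<Rightarrow> 'w \<Rightarrow> real ^ 'n"
  assumes "d \<ge> 1" and "CARD('n) = d + 1"
    and "\<And>N. prob_space (M N)"
    and "\<And>N. prob_space.indep_vars (M N) (\<lambda>_. uniform_sphere) (X N) {1..N}"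
    and "\<And>N i. i \<in> {1..N} \<Longrightarrow> distr (M N) uniform_sphere (X N i) = uniform_sphere"
  shows "((\<lambda>N. prob_space.expectation (M N)
             (\<lambda>\<omega>. real N powr (2 / real d) * separation N (\<lambda>i. X N i \<omega>)))
           \<longlonglongrightarrow> (kappa d / 2) powr (- 1 / real d) * Gamma (1 + 1 / real d)) \<and>
         ((\<lambda>N. prob_space.variance (M N)
             (\<lambda>\<omega>. real N powr (2 / real d) * separation N (\<lambda>i. X N i \<omega>)))
           \<longlonglongrightarrow> (kappa d / 2) powr (- 2 / real d)
               * (Gamma (1 + 2 / real d) - (Gamma (1 + 1 / real d))\<^sup>2))"
proof -
  note d = assms(1)
  have n: "CARD('n) = Suc d" using assms(2) by simp
  define S where "S N = (sphere_sample N :: (nat \<Rightarrow> real ^ 'n) measure)" for N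
  define Y where "Y N x = real N powr (2 / real d) * separation N x" for N and x :: "nat \<Rightarrow> real ^ 'n"
  define Z where "Z N \<omega> = Y N (\<lambda>i. X N i \<omega>)" for N \<omega>
  define R where "R N \<omega> = (\<lambda>i\<in>{1..N}. X N i \<omega>)" for N \<omega>
  have Z: "Z N \<omega> = Y N (R N \<omega>)" for N \<omega>
    using separation_restrict [of N "\<lambda>i. X N i \<omega>"] by (simp add: Z_def Y_def R_def)
  have Ym: "Y N \<in> borel_measurable (S N)" if "N \<ge> 2" for N
    unfolding Y_def S_def using that
    by (intro borel_measurable_times borel_measurable_const borel_measurable_separation)
  have rv: "X N i \<in> M N \<rightarrow>\<^sub>M uniform_sphere" if "i \<in> {1..N}" for N i
    using assms(4) [of N] that by (simp add: prob_space.indep_vars_def [OF assms(3)])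
  have R: "R N \<in> M N \<rightarrow>\<^sub>M S N" for N
    unfolding R_def S_def by (rule measurable_restrict) (rule rv)
  have distr: "distr (M N) (S N) (R N) = S N" if "N \<ge> 2" for N
  proof -
    have "distr (M N) (S N) (R N) = (\<Pi>\<^sub>M i\<in>{1..N}. distr (M N) uniform_sphere (X N i))"
      using prob_space.indep_vars_iff_distr_eq_PiM' [OF assms(3) [of N],
          where I = "{1..N}" and M' = "\<lambda>_. uniform_sphere" and X = "X N"]
        assms(4) [of N] rv that
      unfolding R_def S_def by auto
    also have "\<dots> = S N"
      unfolding S_def by (intro PiM_cong refl assms(5))
    finally show ?thesis .
  qed
  have expect: "prob_space.expectation (M N) (\<lambda>\<omega>. Z N \<omega> ^ m) = (\<integral>x. Y N x ^ m \<partial>S N)" if N: "N \<ge> 2" for N m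
  proof -
    have "(\<integral>x. Y N x ^ m \<partial>S N) = (\<integral>x. Y N x ^ m \<partial>distr (M N) (S N) (R N))"
      by (simp only: distr [OF N])
    also have "\<dots> = (\<integral>\<omega>. Y N (R N \<omega>) ^ m \<partial>M N)"
      by (intro integral_distr R borel_measurable_power Ym N)
    finally show ?thesis by (simp add: Z)
  qed
  have moments: "(\<lambda>N. prob_space.expectation (M N) (\<lambda>\<omega>. Z N \<omega> ^ m))
      \<longlonglongrightarrow> (kappa d / 2) powr (- real m / real d) * Gamma (1 + real m / real d)" if "m \<ge> 1" for m
    using separation_moment_tendsto [OF n d that]
  proof (rule Lim_transform_eventually)
    show "\<forall>\<^sub>F N in sequentially. (\<integral>x. (real N powr (2 / real d) * separation N x) ^ m \<partial>(sphere_sample N :: (nat \<Rightarrow> real ^ 'n) measure))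
        = prob_space.expectation (M N) (\<lambda>\<omega>. Z N \<omega> ^ m)"
      using eventually_ge_at_top [of 2] by eventually_elim (simp only: expect S_def Y_def)
  qed
  have mean: "(\<lambda>N. prob_space.expectation (M N) (Z N))
      \<longlonglongrightarrow> (kappa d / 2) powr (- 1 / real d) * Gamma (1 + 1 / real d)"
    using moments [of 1] by simp
  have var: "prob_space.variance (M N) (Z N) =
      prob_space.expectation (M N) (\<lambda>\<omega>. Z N \<omega> ^ 2) - (prob_space.expectation (M N) (Z N))\<^sup>2" if N: "N \<ge> 2" for N
  proof -
    interpret prob_space "M N" by (rule assms)
    have Zm [measurable]: "Z N \<in> borel_measurable (M N)"
      using measurable_compose [OF R Ym [OF N]] by (simp add: Z [abs_def])
    have bound: "\<bar>Z N \<omega>\<bar> \<le> real N powr (2 / real d) * pi" if "\<omega> \<in> space (M N)" for \<omega>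
    proof -
      have "R N \<omega> \<in> space (sphere_sample N)" using measurable_space [OF R that] by (simp add: S_def)
      then show ?thesis
        using separation_bounds [OF N, of "R N \<omega>"] by (simp add: Z Y_def abs_mult mult_left_mono)
    qed
    have "integrable (M N) (Z N)"
      by (rule integrable_const_bound [of _ "real N powr (2 / real d) * pi"]) (use bound in auto)
    moreover have "integrable (M N) (\<lambda>\<omega>. (Z N \<omega>)\<^sup>2)"
    proof (rule integrable_const_bound [of _ "(real N powr (2 / real d) * pi)\<^sup>2"])
      show "AE \<omega> in M N. norm ((Z N \<omega>)\<^sup>2) \<le> (real N powr (2 / real d) * pi)\<^sup>2"
      proof (rule AE_I2)
        fix \<omega> assume "\<omega> \<in> space (M N)"
        then have "\<bar>Z N \<omega>\<bar> ^ 2 \<le> (real N powr (2 / real d) * pi)\<^sup>2"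
          using bound by (intro power_mono) auto
        then show "norm ((Z N \<omega>)\<^sup>2) \<le> (real N powr (2 / real d) * pi)\<^sup>2" by simp
      qed
    qed simp
    ultimately show ?thesis by (rule variance_eq)
  qed
  have "(\<lambda>N. prob_space.expectation (M N) (\<lambda>\<omega>. Z N \<omega> ^ 2) - (prob_space.expectation (M N) (Z N))\<^sup>2)
      \<longlonglongrightarrow> (kappa d / 2) powr (- 2 / real d) * Gamma (1 + 2 / real d)
         - ((kappa d / 2) powr (- 1 / real d) * Gamma (1 + 1 / real d))\<^sup>2"
    using moments [of 2] mean by (intro tendsto_diff tendsto_power) auto
  also have "((kappa d / 2) powr (- 1 / real d) * Gamma (1 + 1 / real d))\<^sup>2
      = (kappa d / 2) powr (- 2 / real d) * (Gamma (1 + 1 / real d))\<^sup>2"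
  proof -
    have "((kappa d / 2) powr (- 1 / real d))\<^sup>2 = (kappa d / 2) powr (- 1 / real d + - 1 / real d)"
      by (simp only: power2_eq_square powr_add)
    then show ?thesis by (simp add: power_mult_distrib)
  qed
  finally have "(\<lambda>N. prob_space.variance (M N) (Z N)) \<longlonglongrightarrow>
      (kappa d / 2) powr (- 2 / real d) * (Gamma (1 + 2 / real d) - (Gamma (1 + 1 / real d))\<^sup>2)"
    unfolding right_diff_distrib
  proof (rule Lim_transform_eventually)
    show "\<forall>\<^sub>F N in sequentially. prob_space.expectation (M N) (\<lambda>\<omega>. Z N \<omega> ^ 2) - (prob_space.expectation (M N) (Z N))\<^sup>2
       = prob_space.variance (M N) (Z N)"
      using eventually_ge_at_top [of 2] by eventually_elim (simp only: var)
  qed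
  then show ?thesis using mean by (simp add: Z_def [abs_def] Y_def)
qed

end
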